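(* Let $a,b\in\mathbb{R}$ with $0<b<a<\pi$, let $k\in\mathbb{N}_0=\{0,1,2,\ldots\}$, and let $\mu,\nu\in\mathbb{C}$ with $\operatorname{Re}(\mu)>2k-\tfrac12$ and $\operatorname{Re}(\nu)>-\tfrac12$. Then $$\int_0^\infty\frac{J_\mu(at)J_\nu(bt)}{t^{\mu+\nu-2k}}\,dt=\sum_{n=0}^\infty\varepsilon_n\,\frac{J_\mu(an)J_\nu(bn)}{n^{\mu+\nu-2k}},$$ where $\varepsilon_0=\tfrac12$ and $\varepsilon_n=1$ for $n\ge1$.
   Context: $J_\nu(z)=\sum_{n=0}^\infty \frac{(-1)^n}{\Gamma(\nu+n+1)\,n!}\left(\frac z2\right)^{\nu+2n}$ is the Bessel function of the first kind. The $n=0$ term of the series is understood as $\varepsilon_0$ times the limit of $\frac{J_\mu(at)J_\nu(bt)}{t^{\mu+\nu-2k}}$ as $t\to0^+$; this limit exists because $J_\nu(z)\left(\frac z2\right)^{-\nu}$ is entire in $z$ with value $\frac1{\Gamma(\nu+1)}$ at $z=0$. The integral is an improper integral $\lim_{T\to\infty}\int_0^T$ and the series is the limit of its partial sums (neither need converge absolutely). *)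

theory Defs
  imports "HOL-Analysis.Analysis"
begin

text \<open>
  Bessel function of the first kind of complex order, on the principal branch of the power.
  \<^const>\<open>rGamma\<close> is the reciprocal Gamma function. Since \<open>0 powr s = 0\<close> for every \<open>s\<close>, the value
  at \<open>z = 0\<close> is \<open>0\<close>, which is not the conventional one for \<open>J\<^sub>0\<close>.
\<close>

definition bessel_J :: "complex \<Rightarrow> complex \<Rightarrow> complex" where
  "bessel_J \<nu> z =
     (\<Sum>n. (-1) ^ n * rGamma (\<nu> + of_nat n + 1) / fact n * (z / 2) powr (\<nu> + 2 * of_nat n))"

text \<open>Meaningful for \<open>t > 0\<close> only; at \<open>t = 0\<close> it takes the junk value \<open>0\<close>.\<close>

definition bessel_quotient ::
  "real \<Rightarrow> real \<Rightarrow> nat \<Rightarrow> complex \<Rightarrow> complex \<Rightarrow> real \<Rightarrow> complex" where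
  "bessel_quotient a b k \<mu> \<nu> t =
     bessel_J \<mu> (of_real (a * t)) * bessel_J \<nu> (of_real (b * t))
       / of_real t powr (\<mu> + \<nu> - 2 * of_nat k)"

definition neumann_factor :: "nat \<Rightarrow> complex" where
  "neumann_factor n = (if n = 0 then 1 / 2 else 1)"

end

theory Submission
  imports Defs "HOL-Complex_Analysis.Complex_Analysis" "HOL-Real_Asymp.Real_Asymp"
begin

text \<open>
  Up to a constant factor, the integrand is the restriction to \<open>t > 0\<close> of the entire even function
  \<open>F(z) = z\<^sup>2\<^sup>k G\<^sub>\<mu>(a z) G\<^sub>\<nu>(b z)\<close>, where \<open>G\<^sub>\<nu>(z) = (z/2)\<^sup>-\<^sup>\<nu> J\<^sub>\<nu>(z)\<close>. It has exponential type \<open>a + b < 2 \<pi>\<close>, so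
  its Fourier transform lives strictly inside \<open>(- 2 \<pi>, 2 \<pi>)\<close>, and Poisson summation equates the sum of \<open>F\<close>
  over the integers with its integral over the line; halving by evenness gives the claim. The proof
  makes this precise without Fourier transforms, since \<open>F\<close> need not be integrable.

  The equality comes from residues. Integrating \<open>F(z) / (exp (2 \<pi> i z) - 1)\<close> around a rectangle that crosses the
  real axis at \<open>\<plusminus>(N + 1/2)\<close> yields the sum of \<open>F(n)\<close> over \<open>\<bar>n\<bar> \<le> N\<close>; in the upper half plane the kernel is
  \<open>- 1\<close> plus a part that decays like \<open>exp (- 2 \<pi> Im z)\<close>, and the \<open>- 1\<close> contributes exactly the integral of \<open>F\<close> over
  \<open>[- N - 1/2, N + 1/2]\<close>. What remains tends to \<open>0\<close> as soon as \<open>F(x + i y) = O((1 + \<bar>x\<bar>)\<^sup>-\<^sup>\<epsilon> exp (c \<bar>y\<bar>))\<close> with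
  \<open>\<epsilon> > 0\<close> and \<open>c < 2 \<pi>\<close> (lemma \<open>sum_minus_integral_tendsto_0\<close>).

  That bound, with \<open>\<epsilon> = Re (\<mu> + \<nu> - 2 k) + 1\<close>, is obtained from Bessel's differential equation alone, by Gronwall
  estimates for energies. On the positive axis \<open>U(x) = x\<^sup>\<nu>\<^sup>+\<^sup>1\<^sup>/\<^sup>2 G\<^sub>\<nu>(x)\<close> solves \<open>U'' = - (1 + O(x\<^sup>-\<^sup>2)) U\<close> and therefore stays
  bounded at infinity, which gives the decay in \<open>x\<close>; along vertical lines \<open>\<bar>G\<bar>\<^sup>2 + \<bar>G'\<bar>\<^sup>2\<close> grows at most like \<open>exp ((2 + 2 \<delta>) \<bar>y\<bar>)\<close>
  (lemma \<open>bessel_even_exp_type_bound\<close>).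

  Convergence of the improper integral uses \<open>a \<noteq> b\<close>. For the solutions \<open>u\<close> and \<open>v\<close> belonging to \<open>U\<^sub>\<mu>(a t)\<close> and
  \<open>U\<^sub>\<nu>(b t)\<close>, the Wronskian \<open>W = u v' - u' v\<close> satisfies \<open>W' = (a\<^sup>2 - b\<^sup>2 + O(t\<^sup>-\<^sup>2)) u v\<close>, so the integrand is the
  derivative of a multiple of \<open>t\<^sup>-\<^sup>\<sigma> W\<close>, where \<open>\<sigma> = \<mu> + \<nu> - 2 k + 1\<close>, up to an absolutely integrable error (lemma
  \<open>liouville_product_integral_convergent\<close>). The sum then converges because its difference from the
  integral tends to \<open>0\<close>.
\<close>

section \<open>The even entire part of a Bessel function\<close>

definition bessel_coeff :: "complex \<Rightarrow> nat \<Rightarrow> complex" where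
  "bessel_coeff \<nu> n = (-1) ^ n * rGamma (\<nu> + of_nat n + 1) / fact n"

text \<open>
  The functional equation of the reciprocal Gamma function. Multiplying out the factors, rather than
  dividing by them, keeps the recurrence valid when \<open>\<nu>\<close> is a negative integer.
\<close>

lemma bessel_coeff_Suc:
  "of_nat (Suc n) * (\<nu> + of_nat n + 1) * bessel_coeff \<nu> (Suc n) = - bessel_coeff \<nu> n"
proof -
  have "rGamma (\<nu> + of_nat n + 1) = (\<nu> + of_nat n + 1) * rGamma (\<nu> + of_nat (Suc n) + 1)"
    using rGamma_plus1[of "\<nu> + of_nat n + 1"] by (simp add: add_ac)
  then show ?thesis
    unfolding bessel_coeff_def by (simp add: field_simps del: of_nat_Suc)
qed

lemma summable_bessel_coeff: "summable (\<lambda>n. bessel_coeff \<nu> n * w ^ n)"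
proof -
  obtain N :: nat where N: "real N \<ge> norm \<nu> + 2 * norm w + 1"
    using real_arch_simple by blast
  show ?thesis
  proof (rule summable_ratio_test[of "1/2" N])
    fix n assume "n \<ge> N"
    then have n: "real n \<ge> norm \<nu> + 2 * norm w + 1"
      using N by linarith
    have "real n + 1 = norm ((\<nu> + of_nat n + 1) - \<nu>)"
      by (metis (no_types, lifting) add.assoc add_diff_cancel_left' norm_of_nat of_nat_1 of_nat_add)
    then have "real n + 1 \<le> norm (\<nu> + of_nat n + 1) + norm \<nu>"
      using norm_triangle_ineq4[of "\<nu> + of_nat n + 1" \<nu>] by simp
    then have *: "2 * norm w + 1 \<le> norm (\<nu> + of_nat n + 1)"
      using n by linarith
    have "norm (bessel_coeff \<nu> n) = real (Suc n) * norm (\<nu> + of_nat n + 1) * norm (bessel_coeff \<nu> (Suc n))"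
      by (metis bessel_coeff_Suc norm_minus_cancel norm_mult norm_of_nat)
    also have "\<dots> \<ge> 1 * (2 * norm w + 1) * norm (bessel_coeff \<nu> (Suc n))"
      using * by (intro mult_mono mult_nonneg_nonneg) auto
    finally have "2 * norm w * norm (bessel_coeff \<nu> (Suc n)) \<le> norm (bessel_coeff \<nu> n)"
      by (simp add: algebra_simps) (smt (verit) norm_ge_zero)
    then have "2 * norm w * norm (bessel_coeff \<nu> (Suc n)) * norm w ^ n \<le> norm (bessel_coeff \<nu> n) * norm w ^ n"
      by (intro mult_right_mono) auto
    then show "norm (bessel_coeff \<nu> (Suc n) * w ^ Suc n) \<le> 1/2 * norm (bessel_coeff \<nu> n * w ^ n)"
      by (simp add: norm_mult norm_power mult_ac)
  qed simp
qed

text \<open>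
  The entire function \<open>(z/2)\<^sup>-\<^sup>\<nu> J\<^sub>\<nu>(z)\<close>, followed by its derivative.
\<close>

definition bessel_even :: "complex \<Rightarrow> complex \<Rightarrow> complex" where
  "bessel_even \<nu> z = (\<Sum>n. bessel_coeff \<nu> n * (z\<^sup>2 / 4) ^ n)"

definition bessel_even' :: "complex \<Rightarrow> complex \<Rightarrow> complex" where
  "bessel_even' \<nu> z = z / 2 * (\<Sum>n. diffs (bessel_coeff \<nu>) n * (z\<^sup>2 / 4) ^ n)"

lemma bessel_even_minus [simp]: "bessel_even \<nu> (- z) = bessel_even \<nu> z"
  by (simp add: bessel_even_def)

lemma bessel_J_eq_bessel_even:
  assumes "z \<noteq> 0"
  shows "bessel_J \<nu> z = (z / 2) powr \<nu> * bessel_even \<nu> z"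
proof -
  have "(z / 2) powr (\<nu> + 2 * of_nat n) = (z / 2) powr \<nu> * (z\<^sup>2 / 4) ^ n" for n
  proof -
    have "(z / 2) powr (2 * of_nat n) = (z / 2) powr (of_nat (2 * n))"
      by simp
    also have "\<dots> = (z / 2) ^ (2 * n)"
      using assms by (subst powr_nat) auto
    also have "\<dots> = (z\<^sup>2 / 4) ^ n"
      by (simp add: power_mult power_divide)
    finally show ?thesis
      by (simp add: powr_add)
  qed
  then have "bessel_J \<nu> z = (\<Sum>n. (z / 2) powr \<nu> * (bessel_coeff \<nu> n * (z\<^sup>2 / 4) ^ n))"
    unfolding bessel_J_def bessel_coeff_def by (intro arg_cong[where f = suminf]) (auto simp: mult_ac)
  then show ?thesis
    unfolding bessel_even_def using suminf_mult[OF summable_bessel_coeff] by simp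
qed

lemma DERIV_bessel_even: "(bessel_even \<nu> has_field_derivative bessel_even' \<nu> z) (at z)"
proof -
  have "((\<lambda>w. \<Sum>n. bessel_coeff \<nu> n * w ^ n) has_field_derivative
          (\<Sum>n. diffs (bessel_coeff \<nu>) n * (z\<^sup>2 / 4) ^ n)) (at (z\<^sup>2 / 4))"
    by (intro termdiffs_strong_converges_everywhere summable_bessel_coeff)
  moreover have "((\<lambda>z. z\<^sup>2 / 4) has_field_derivative z / 2) (at z)"
    by (auto intro!: derivative_eq_intros)
  ultimately show ?thesis
    unfolding bessel_even_def bessel_even'_def mult.commute[of "z / 2"] by (rule DERIV_chain2)
qed

text \<open>
  This is Bessel's differential equation \<open>G'' + (2 \<nu> + 1)/z G' + G = 0\<close>. In the variable \<open>w = z\<^sup>2/4\<close> it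
  reads \<open>w H'' + (\<nu> + 1) H' + H = 0\<close>, which is the coefficient recurrence summed over all powers of \<open>w\<close>.
\<close>

lemma DERIV_bessel_even':
  assumes "z \<noteq> 0"
  shows "(bessel_even' \<nu> has_field_derivative
            - bessel_even \<nu> z - (2 * \<nu> + 1) / z * bessel_even' \<nu> z) (at z)"
proof -
  define c where "c = bessel_coeff \<nu>"
  have s0: "summable (\<lambda>n. c n * w ^ n)" for w
    unfolding c_def by (rule summable_bessel_coeff)
  have s1: "summable (\<lambda>n. diffs c n * w ^ n)" for w
    by (rule termdiff_converges_all) (rule s0)
  have s2: "summable (\<lambda>n. diffs (diffs c) n * w ^ n)" for w
    by (rule termdiff_converges_all) (rule s1)
  define H0 where "H0 w = (\<Sum>n. c n * w ^ n)" for w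
  define H1 where "H1 w = (\<Sum>n. diffs c n * w ^ n)" for w
  define H2 where "H2 w = (\<Sum>n. diffs (diffs c) n * w ^ n)" for w
  have ode: "w * H2 w + (\<nu> + 1) * H1 w + H0 w = 0" for w
  proof -
    have "(\<lambda>n. w * (of_nat n * diffs c n * w ^ (n - Suc 0))) sums (w * H2 w)"
      unfolding H2_def by (intro sums_mult diffs_equiv s2)
    moreover have "(\<lambda>n. (\<nu> + 1) * (diffs c n * w ^ n)) sums ((\<nu> + 1) * H1 w)"
      unfolding H1_def by (intro sums_mult summable_sums s1)
    moreover have "(\<lambda>n. c n * w ^ n) sums H0 w"
      unfolding H0_def by (intro summable_sums s0)
    ultimately have "(\<lambda>n. w * (of_nat n * diffs c n * w ^ (n - Suc 0))
        + (\<nu> + 1) * (diffs c n * w ^ n) + c n * w ^ n) sums (w * H2 w + (\<nu> + 1) * H1 w + H0 w)"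
      by (intro sums_add)
    moreover have "w * (of_nat n * diffs c n * w ^ (n - Suc 0))
        + (\<nu> + 1) * (diffs c n * w ^ n) + c n * w ^ n = 0" for n
    proof -
      have "w * (of_nat n * diffs c n * w ^ (n - Suc 0)) = of_nat n * diffs c n * w ^ n"
        by (cases n) auto
      then have "w * (of_nat n * diffs c n * w ^ (n - Suc 0))
        + (\<nu> + 1) * (diffs c n * w ^ n) + c n * w ^ n = ((\<nu> + of_nat n + 1) * diffs c n + c n) * w ^ n"
        by (simp add: algebra_simps)
      also have "(\<nu> + of_nat n + 1) * diffs c n + c n = 0"
        using bessel_coeff_Suc[of n \<nu>] by (simp add: c_def diffs_def mult_ac del: of_nat_Suc)
      finally show ?thesis by simp
    qed
    ultimately show ?thesis
      using sums_unique2[OF sums_zero] by simp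
  qed
  have "(H1 has_field_derivative H2 (z\<^sup>2 / 4)) (at (z\<^sup>2 / 4))"
    unfolding H1_def[abs_def] H2_def by (intro termdiffs_strong_converges_everywhere s1)
  moreover have "((\<lambda>z. z\<^sup>2 / 4) has_field_derivative z / 2) (at z)"
    by (auto intro!: derivative_eq_intros)
  ultimately have d: "((\<lambda>z. H1 (z\<^sup>2 / 4)) has_field_derivative H2 (z\<^sup>2 / 4) * (z / 2)) (at z)"
    by (rule DERIV_chain2)
  have e': "bessel_even' \<nu> = (\<lambda>z. z / 2 * H1 (z\<^sup>2 / 4))"
    by (simp add: bessel_even'_def H1_def c_def fun_eq_iff)
  have e0: "bessel_even \<nu> z = H0 (z\<^sup>2 / 4)"
    by (simp add: bessel_even_def H0_def c_def)
  have h: "((\<lambda>z. z / 2) has_field_derivative 1 / 2) (at z)"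
    by (auto intro!: derivative_eq_intros)
  have "((\<lambda>z. z / 2 * H1 (z\<^sup>2 / 4)) has_field_derivative
      H1 (z\<^sup>2 / 4) / 2 + z\<^sup>2 / 4 * H2 (z\<^sup>2 / 4)) (at z)"
    using DERIV_mult[OF h d] by (simp add: power2_eq_square mult_ac)
  moreover have "H1 (z\<^sup>2 / 4) / 2 + z\<^sup>2 / 4 * H2 (z\<^sup>2 / 4)
      = - bessel_even \<nu> z - (2 * \<nu> + 1) / z * bessel_even' \<nu> z"
  proof -
    have "z\<^sup>2 / 4 * H2 (z\<^sup>2 / 4) = - (\<nu> + 1) * H1 (z\<^sup>2 / 4) - H0 (z\<^sup>2 / 4)"
      using ode[of "z\<^sup>2 / 4"] by algebra
    moreover have "(2 * \<nu> + 1) / z * (z / 2 * H1 (z\<^sup>2 / 4)) = (2 * \<nu> + 1) / 2 * H1 (z\<^sup>2 / 4)"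
      using assms by simp
    moreover have "h1 / 2 + (- (\<nu> + 1) * h1 - h0) = - h0 - (2 * \<nu> + 1) / 2 * h1" for h0 h1
      by (simp add: field_simps)
    ultimately show ?thesis
      unfolding e' e0 by (simp only:)
  qed
  ultimately show ?thesis
    unfolding e' by simp
qed

section \<open>Energy estimates from the differential equation\<close>

lemma gronwall_exp:
  fixes e \<phi> :: "real \<Rightarrow> real"
  assumes "t0 \<le> t"
    and e: "\<And>s. s \<in> {t0..t} \<Longrightarrow> (e has_real_derivative e' s) (at s)"
    and \<phi>: "\<And>s. s \<in> {t0..t} \<Longrightarrow> (\<phi> has_real_derivative \<phi>' s) (at s)"
    and le: "\<And>s. s \<in> {t0..t} \<Longrightarrow> e' s \<le> \<phi>' s * e s"
  shows "e t \<le> e t0 * exp (\<phi> t - \<phi> t0)"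
proof -
  have "e t * exp (- \<phi> t) \<le> e t0 * exp (- \<phi> t0)"
  proof (rule DERIV_nonpos_imp_nonincreasing[OF \<open>t0 \<le> t\<close>])
    fix s assume "t0 \<le> s" "s \<le> t"
    then have s: "s \<in> {t0..t}" by simp
    have "((\<lambda>s. e s * exp (- \<phi> s)) has_real_derivative (e' s - \<phi>' s * e s) * exp (- \<phi> s)) (at s)"
      by (rule derivative_eq_intros e[OF s] \<phi>[OF s] refl)+ (simp add: algebra_simps)
    moreover have "(e' s - \<phi>' s * e s) * exp (- \<phi> s) \<le> 0"
      using le[OF s] by (intro mult_nonpos_nonneg) auto
    ultimately show "\<exists>y. ((\<lambda>s. e s * exp (- \<phi> s)) has_real_derivative y) (at s) \<and> y \<le> 0"
      by blast
  qed
  then have "e t * exp (- \<phi> t) * exp (\<phi> t) \<le> e t0 * exp (- \<phi> t0) * exp (\<phi> t)"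
    by (intro mult_right_mono) auto
  then show ?thesis
    by (simp add: exp_minus exp_diff field_simps)
qed

lemma energy_has_derivative:
  fixes w v :: "real \<Rightarrow> complex"
  assumes "(w has_vector_derivative w') (at t)" "(v has_vector_derivative v') (at t)"
  shows "((\<lambda>t. (norm (w t))\<^sup>2 + (norm (v t))\<^sup>2) has_real_derivative
           2 * (w t \<bullet> w') + 2 * (v t \<bullet> v')) (at t)"
proof -
  have "((\<lambda>t. w t \<bullet> w t + v t \<bullet> v t) has_vector_derivative
      (w t \<bullet> w' + w' \<bullet> w t) + (v t \<bullet> v' + v' \<bullet> v t)) (at t)"
    by (intro has_vector_derivative_add bounded_bilinear.has_vector_derivative[OF bounded_bilinear_inner] assms)
  then show ?thesis
    by (simp add: has_real_derivative_iff_has_vector_derivative power2_norm_eq_inner inner_commute)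
qed

lemma two_mult_le_sum_squares: "2 * x * y \<le> x\<^sup>2 + (y::real)\<^sup>2"
  using sum_squares_bound by (simp add: mult_ac)

definition bessel_energy :: "complex \<Rightarrow> complex \<Rightarrow> real" where
  "bessel_energy \<nu> z = (norm (bessel_even \<nu> z))\<^sup>2 + (norm (bessel_even' \<nu> z))\<^sup>2"

lemma bessel_energy_minus [simp]: "bessel_energy \<nu> (- z) = bessel_energy \<nu> z"
  by (simp add: bessel_energy_def bessel_even'_def)

lemma bessel_energy_nonneg [simp]: "bessel_energy \<nu> z \<ge> 0"
  by (simp add: bessel_energy_def)

lemma norm_bessel_even_le: "norm (bessel_even \<nu> z) \<le> sqrt (bessel_energy \<nu> z)"
  by (intro real_le_rsqrt) (simp add: bessel_energy_def)

text \<open>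
  Far from the origin the friction term \<open>(2 \<nu> + 1)/z G'\<close> is a small perturbation of \<open>G'' = - G\<close>, whose
  solutions grow at most like \<open>exp \<bar>y\<bar>\<close> in any direction. The unit vector \<open>d\<close> allows upward and downward vertical
  rays to be treated alike.
\<close>

lemma bessel_energy_ray_le:
  assumes d: "norm d = 1" and "\<delta> > 0" "y \<ge> 0"
    and far: "\<And>s. s \<in> {0..y} \<Longrightarrow> z0 + of_real s * d \<noteq> 0 \<and> norm (2 * \<nu> + 1) \<le> \<delta> * norm (z0 + of_real s * d)"
  shows "bessel_energy \<nu> (z0 + of_real y * d) \<le> bessel_energy \<nu> z0 * exp ((2 + 2 * \<delta>) * y)"
proof -
  let ?z = "\<lambda>s::real. z0 + of_real s * d"
  let ?G = "\<lambda>s. bessel_even \<nu> (?z s)" and ?G' = "\<lambda>s. bessel_even' \<nu> (?z s)"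
  let ?G'' = "\<lambda>s. - ?G s - (2 * \<nu> + 1) / ?z s * ?G' s"
  have lin: "((\<lambda>w. z0 + w * d) has_field_derivative d) (at w)" for w
    by (auto intro!: derivative_eq_intros)
  have "bessel_energy \<nu> (?z y) \<le> bessel_energy \<nu> (?z 0) * exp ((2 + 2 * \<delta>) * y - (2 + 2 * \<delta>) * 0)"
    unfolding bessel_energy_def
  proof (rule gronwall_exp[OF \<open>y \<ge> 0\<close>])
    fix s assume s: "s \<in> {0..y}"
    have 1: "(?G has_vector_derivative ?G' s * d) (at s)"
      by (rule has_vector_derivative_real_field[where f = "\<lambda>w. bessel_even \<nu> (z0 + w * d)"],
          rule DERIV_chain2[OF DERIV_bessel_even lin])
    have 2: "(?G' has_vector_derivative ?G'' s * d) (at s)"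
      by (rule has_vector_derivative_real_field[where f = "\<lambda>w. bessel_even' \<nu> (z0 + w * d)"],
          rule DERIV_chain2[OF DERIV_bessel_even' lin]) (use far[OF s] in auto)
    show "((\<lambda>s. (norm (?G s))\<^sup>2 + (norm (?G' s))\<^sup>2) has_real_derivative
        2 * (?G s \<bullet> (?G' s * d)) + 2 * (?G' s \<bullet> (?G'' s * d))) (at s)"
      by (rule energy_has_derivative[OF 1 2])
    show "((*) (2 + 2 * \<delta>) has_real_derivative (2 + 2 * \<delta>)) (at s)"
      by (auto intro!: derivative_eq_intros)
    define g g' where "g = norm (?G s)" and "g' = norm (?G' s)"
    have pos: "g \<ge> 0" "g' \<ge> 0"
      by (auto simp: g_def g'_def)
    have "?G s \<bullet> (?G' s * d) \<le> g * g'"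
      using Cauchy_Schwarz_ineq2[of "?G s" "?G' s * d"] d by (simp add: g_def g'_def norm_mult)
    moreover have "?G' s \<bullet> (?G'' s * d) \<le> g' * (g + \<delta> * g')"
    proof -
      have "norm ((2 * \<nu> + 1) / ?z s) \<le> \<delta>"
        using far[OF s] by (simp add: norm_divide divide_le_eq)
      then have "norm ((2 * \<nu> + 1) / ?z s * ?G' s) \<le> \<delta> * g'"
        unfolding norm_mult g'_def by (intro mult_right_mono) auto
      then have "norm (?G'' s) \<le> g + \<delta> * g'"
        using norm_triangle_ineq4[of "- ?G s" "(2 * \<nu> + 1) / ?z s * ?G' s"] by (simp add: g_def)
      then have "norm (?G' s) * norm (?G'' s * d) \<le> g' * (g + \<delta> * g')"
        using d unfolding norm_mult g'_def by (intro mult_left_mono) auto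
      then show ?thesis
        using Cauchy_Schwarz_ineq2[of "?G' s" "?G'' s * d"] by linarith
    qed
    moreover have "2 * (g * g') + 2 * (g' * (g + \<delta> * g')) \<le> (2 + 2 * \<delta>) * (g\<^sup>2 + g'\<^sup>2)"
    proof -
      have "(2 + 2 * \<delta>) * (g\<^sup>2 + g'\<^sup>2) - (2 * (g * g') + 2 * (g' * (g + \<delta> * g'))) = 2 * (g - g')\<^sup>2 + 2 * \<delta> * g\<^sup>2"
        by (simp add: power2_eq_square algebra_simps)
      moreover have "\<dots> \<ge> 0"
        using \<open>\<delta> > 0\<close> by simp
      ultimately show ?thesis by linarith
    qed
    ultimately show "2 * (?G s \<bullet> (?G' s * d)) + 2 * (?G' s \<bullet> (?G'' s * d))
        \<le> (2 + 2 * \<delta>) * ((norm (?G s))\<^sup>2 + (norm (?G' s))\<^sup>2)"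
      unfolding g_def g'_def by linarith
  qed
  then show ?thesis by simp
qed

text \<open>
  Liouville's transformation, which removes the first-order term from Bessel's equation, followed by
  the derivative of the transformed function.
\<close>

definition bessel_liouville :: "complex \<Rightarrow> complex \<Rightarrow> complex" where
  "bessel_liouville \<nu> z = z powr (\<nu> + 1/2) * bessel_even \<nu> z"

definition bessel_liouville' :: "complex \<Rightarrow> complex \<Rightarrow> complex" where
  "bessel_liouville' \<nu> z = z powr (\<nu> + 1/2) * ((\<nu> + 1/2) / z * bessel_even \<nu> z + bessel_even' \<nu> z)"

lemma DERIV_powr_divide:
  fixes z s :: complex
  assumes "z \<notin> \<real>\<^sub>\<le>\<^sub>0"
  shows "((\<lambda>z. z powr s) has_field_derivative z powr s * (s / z)) (at z)"
proof -
  have "z \<noteq> 0" using assms by auto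
  then show ?thesis
    using has_field_derivative_powr[OF assms, of s] by (simp add: powr_diff mult_ac)
qed

lemma DERIV_bessel_liouville:
  assumes "z \<notin> \<real>\<^sub>\<le>\<^sub>0"
  shows "(bessel_liouville \<nu> has_field_derivative bessel_liouville' \<nu> z) (at z)"
  unfolding bessel_liouville_def[abs_def] bessel_liouville'_def
  by (rule DERIV_cong[OF DERIV_mult[OF DERIV_powr_divide[OF assms] DERIV_bessel_even]])
     (simp add: algebra_simps)

lemma DERIV_bessel_liouville':
  assumes "z \<notin> \<real>\<^sub>\<le>\<^sub>0"
  shows "(bessel_liouville' \<nu> has_field_derivative
           - (1 + (1/4 - \<nu>\<^sup>2) / z\<^sup>2) * bessel_liouville \<nu> z) (at z)"
proof -
  have nz: "z \<noteq> 0" using assms by auto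
  define s where "s = \<nu> + 1/2"
  have c: "2 * \<nu> + 1 = 2 * s" "1/4 - \<nu>\<^sup>2 = s - s\<^sup>2"
    by (auto simp: s_def power2_eq_square algebra_simps)
  define P G G' where "P = z powr s" and "G = bessel_even \<nu> z" and "G' = bessel_even' \<nu> z"
  have d1: "((\<lambda>z. s / z) has_field_derivative - s / z\<^sup>2) (at z)"
    using nz by (auto intro!: derivative_eq_intros simp: power2_eq_square)
  have "(bessel_liouville' \<nu> has_field_derivative
      P * (s / z) * (s / z * G + G') + ((- s / z\<^sup>2 * G + G' * (s / z)) + (- G - 2 * s / z * G')) * P) (at z)"
    unfolding bessel_liouville'_def[abs_def] s_def[symmetric] P_def G_def G'_def
    by (rule DERIV_mult DERIV_add DERIV_powr_divide[OF assms] d1 DERIV_bessel_even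
        DERIV_bessel_even'[of z \<nu>, OF nz, unfolded c])+
  moreover have "P * (s / z) * (s / z * G + G') + ((- s / z\<^sup>2 * G + G' * (s / z)) + (- G - 2 * s / z * G')) * P
     = - (1 + (s - s\<^sup>2) / z\<^sup>2) * (P * G)"
  proof -
    define r where "r = inverse z"
    have "P * (s * r) * (s * r * G + G') + ((- s * r\<^sup>2 * G + G' * (s * r)) + (- G - 2 * s * r * G')) * P
       = - (1 + (s - s\<^sup>2) * r\<^sup>2) * (P * G)"
      by algebra
    then show ?thesis
      by (simp only: r_def divide_inverse power_inverse)
  qed
  ultimately show ?thesis
    unfolding bessel_liouville_def c(2) s_def[symmetric] P_def G_def by (simp only:)
qed

text \<open>
  The energy \<open>\<bar>U\<bar>\<^sup>2 + \<bar>U'\<bar>\<^sup>2\<close> has logarithmic derivative \<open>O(t\<^sup>-\<^sup>2)\<close>, which is integrable up to infinity. This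
  replaces the asymptotic expansion of \<open>J\<^sub>\<nu>\<close>.
\<close>

lemma bessel_liouville_bounded:
  assumes "t0 > 0"
  shows "\<exists>C. \<forall>t\<ge>t0. norm (bessel_liouville \<nu> (of_real t)) \<le> C \<and> norm (bessel_liouville' \<nu> (of_real t)) \<le> C"
proof -
  let ?U = "\<lambda>t::real. bessel_liouville \<nu> (of_real t)" and ?U' = "\<lambda>t::real. bessel_liouville' \<nu> (of_real t)"
  define q where "q = 1/4 - \<nu>\<^sup>2"
  let ?U'' = "\<lambda>t. - (1 + q / (of_real t)\<^sup>2) * ?U t"
  let ?e = "\<lambda>t. (norm (?U t))\<^sup>2 + (norm (?U' t))\<^sup>2"
  define K where "K = ?e t0 * exp (norm q / t0)"
  have bound: "?e t \<le> K" if "t \<ge> t0" for t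
  proof -
    have "?e t \<le> ?e t0 * exp (- norm q / t - (- norm q / t0))"
    proof (rule gronwall_exp[OF that])
      fix s assume "s \<in> {t0..t}"
      then have s: "s > 0" using assms by simp
      then have s': "complex_of_real s \<notin> \<real>\<^sub>\<le>\<^sub>0" by simp
      show "(?e has_real_derivative 2 * (?U s \<bullet> ?U' s) + 2 * (?U' s \<bullet> ?U'' s)) (at s)"
        unfolding q_def
        by (intro energy_has_derivative has_vector_derivative_real_field
            DERIV_bessel_liouville DERIV_bessel_liouville' s')
      show "((\<lambda>t. - norm q / t) has_real_derivative norm q / s\<^sup>2) (at s)"
        using s by (auto intro!: derivative_eq_intros simp: power2_eq_square)
      have eq: "?U'' s = - ?U s - q / (of_real s)\<^sup>2 * ?U s"
        by (simp add: algebra_simps)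
      have "2 * (?U s \<bullet> ?U' s) + 2 * (?U' s \<bullet> ?U'' s) = 2 * (?U' s \<bullet> (- (q / (of_real s)\<^sup>2 * ?U s)))"
        unfolding eq by (simp add: inner_diff_right inner_commute)
      also have "\<dots> \<le> 2 * (norm (?U' s) * norm (- (q / (of_real s)\<^sup>2 * ?U s)))"
        by (intro mult_left_mono norm_cauchy_schwarz) auto
      also have "\<dots> = norm q / s\<^sup>2 * (2 * norm (?U s) * norm (?U' s))"
        by (simp add: norm_mult norm_divide norm_power)
      also have "\<dots> \<le> norm q / s\<^sup>2 * ?e s"
        by (intro mult_left_mono two_mult_le_sum_squares) auto
      finally show "2 * (?U s \<bullet> ?U' s) + 2 * (?U' s \<bullet> ?U'' s) \<le> norm q / s\<^sup>2 * ?e s" .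
    qed
    also have "\<dots> \<le> K"
      unfolding K_def using that assms by (intro mult_left_mono) auto
    finally show ?thesis .
  qed
  have "norm (?U t) \<le> sqrt K \<and> norm (?U' t) \<le> sqrt K" if "t \<ge> t0" for t
    using bound[OF that] by (intro conjI real_le_rsqrt) (smt (verit) zero_le_power2)+
  then show ?thesis by blast
qed

section \<open>Growth and decay in the complex plane\<close>

text \<open>
  Undoing Liouville's transformation turns boundedness of \<open>U\<close> and \<open>U'\<close> into decay of \<open>G\<close> and \<open>G'\<close>.
\<close>

lemma bessel_energy_real_le:
  "\<exists>C\<ge>0. \<forall>x\<ge>1. bessel_energy \<nu> (of_real x) \<le> C * (x powr (- Re \<nu> - 1/2))\<^sup>2"
proof -
  obtain C where C: "\<And>t. t \<ge> 1 \<Longrightarrow> norm (bessel_liouville \<nu> (of_real t)) \<le> C"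
      "\<And>t. t \<ge> 1 \<Longrightarrow> norm (bessel_liouville' \<nu> (of_real t)) \<le> C"
    using bessel_liouville_bounded[of 1 \<nu>] by auto
  have C0: "C \<ge> 0"
    using C(1)[of 1] norm_ge_zero order_trans by blast
  define s where "s = \<nu> + 1/2"
  define D where "D = C + norm s * C"
  have D0: "D \<ge> 0" using C0 by (simp add: D_def)
  have "bessel_energy \<nu> (of_real x) \<le> (C\<^sup>2 + D\<^sup>2) * (x powr (- Re \<nu> - 1/2))\<^sup>2" if x: "x \<ge> 1" for x
  proof -
    define G G' where "G = bessel_even \<nu> (of_real x)" and "G' = bessel_even' \<nu> (of_real x)"
    define w where "w = x powr (- Re \<nu> - 1/2)"
    have P: "norm (of_real x powr s) * w = 1"
      using x by (simp add: norm_powr_real_powr w_def s_def flip: powr_add)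
    have w0: "w > 0" using x by (simp add: w_def)
    have "norm (of_real x powr s) * norm G \<le> C"
      using C(1)[OF x] by (simp add: bessel_liouville_def G_def s_def norm_mult)
    then have "(norm (of_real x powr s) * norm G) * w \<le> C * w"
      using w0 by (intro mult_right_mono) auto
    then have "norm G * (norm (of_real x powr s) * w) \<le> C * w"
      by (simp only: mult_ac)
    then have G: "norm G \<le> C * w"
      unfolding P by simp
    have "norm (of_real x powr s) * norm (s / of_real x * G + G') \<le> C"
      using C(2)[OF x] by (simp add: bessel_liouville'_def G_def G'_def s_def norm_mult)
    then have "(norm (of_real x powr s) * norm (s / of_real x * G + G')) * w \<le> C * w"
      using w0 by (intro mult_right_mono) auto
    then have "norm (s / of_real x * G + G') * (norm (of_real x powr s) * w) \<le> C * w"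
      by (simp only: mult_ac)
    then have 1: "norm (s / of_real x * G + G') \<le> C * w"
      unfolding P by simp
    have "norm (s / of_real x * G) \<le> norm s * (C * w)"
      unfolding norm_mult using x by (intro mult_mono G) (auto simp: norm_divide divide_le_eq mult_le_cancel_left1 not_less)
    then have G': "norm G' \<le> D * w"
      using 1 norm_triangle_ineq4[of "s / of_real x * G + G'" "s / of_real x * G"]
      by (simp add: D_def algebra_simps)
    have "(norm G)\<^sup>2 + (norm G')\<^sup>2 \<le> (C * w)\<^sup>2 + (D * w)\<^sup>2"
      by (intro add_mono power_mono G G') auto
    then show ?thesis
      by (simp add: bessel_energy_def G_def G'_def w_def power_mult_distrib algebra_simps)
  qed
  moreover have "C\<^sup>2 + D\<^sup>2 \<ge> 0" by simp
  ultimately show ?thesis by blast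
qed

lemma powr_le_powr_comparable:
  fixes A B K p :: real
  assumes "A > 0" "B > 0" "K > 0" "A \<le> K * B" "B \<le> K * A"
  shows "A powr p \<le> K powr \<bar>p\<bar> * B powr p"
proof (cases "p \<ge> 0")
  case True
  have "A powr p \<le> (K * B) powr p"
    using assms True by (intro powr_mono2) auto
  then show ?thesis
    using assms True by (simp add: powr_mult)
next
  case False
  have "A powr p \<le> (B / K) powr p"
    using assms False by (intro powr_mono2') (auto simp: field_simps)
  also have "\<dots> = K powr \<bar>p\<bar> * B powr p"
    using assms False by (simp add: powr_divide powr_minus field_simps)
  finally show ?thesis .
qed

lemma continuous_on_bessel_energy:
  "continuous_on S (bessel_energy \<nu>)"
proof -
  have 1: "continuous_on S (bessel_even \<nu>)"
    by (meson DERIV_bessel_even DERIV_continuous continuous_at_imp_continuous_on)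
  have "continuous_on UNIV (\<lambda>w. \<Sum>n. diffs (bessel_coeff \<nu>) n * w ^ n)"
    by (intro continuous_at_imp_continuous_on ballI
        DERIV_isCont[OF termdiffs_strong_converges_everywhere] termdiff_converges_all summable_bessel_coeff)
  then have "continuous_on S (\<lambda>z. \<Sum>n. diffs (bessel_coeff \<nu>) n * (z\<^sup>2 / 4) ^ n)"
    by (rule continuous_on_compose2) (auto intro!: continuous_intros)
  then have 2: "continuous_on S (bessel_even' \<nu>)"
    unfolding bessel_even'_def[abs_def] by (intro continuous_intros) auto
  show ?thesis
    unfolding bessel_energy_def[abs_def] by (intro continuous_intros 1 2)
qed

text \<open>
  Outside the vertical strip \<open>\<bar>Re z\<bar> < X\<close> the energy is carried vertically from the real axis, where its
  decay is known. Inside the strip the rays start from the boundary of the square of half-width \<open>X\<close>, so that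
  they avoid the singularity of the equation at the origin; there compactness supplies the initial bound.
\<close>

lemma bessel_even_exp_type_bound:
  assumes "\<delta> > 0"
  shows "\<exists>C\<ge>0. \<forall>z. norm (bessel_even \<nu> z)
           \<le> C * (1 + \<bar>Re z\<bar>) powr (- Re \<nu> - 1/2) * exp ((1 + \<delta>) * \<bar>Im z\<bar>)"
proof -
  define p where "p = - Re \<nu> - 1/2"
  \<comment> \<open>Beyond distance \<open>X\<close> from the origin the friction coefficient is at most \<open>\<delta>\<close>.\<close>
  define X where "X = max 1 (norm (2 * \<nu> + 1) / \<delta>)"
  have X1: "X \<ge> 1" and XK: "norm (2 * \<nu> + 1) \<le> \<delta> * X"
    using assms by (auto simp: X_def max_def field_simps)
  have far: "z \<noteq> 0 \<and> norm (2 * \<nu> + 1) \<le> \<delta> * norm z" if "X \<le> norm z" for z :: complex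
  proof -
    have "\<delta> * X \<le> \<delta> * norm z"
      using that assms by (intro mult_left_mono) auto
    then show ?thesis
      using XK X1 that by auto
  qed
  obtain C where C: "C \<ge> 0" "\<And>x. x \<ge> 1 \<Longrightarrow> bessel_energy \<nu> (of_real x) \<le> C * (x powr p)\<^sup>2"
    using bessel_energy_real_le[of \<nu>] unfolding p_def by blast
  have "compact (cbox (Complex (-X) (-X)) (Complex X X))"
    by (rule compact_cbox)
  then have "bdd_above (bessel_energy \<nu> ` cbox (Complex (-X) (-X)) (Complex X X))"
    by (intro compact_imp_bounded[THEN bounded_imp_bdd_above] compact_continuous_image continuous_on_bessel_energy)
  then obtain M where M: "\<And>z. \<bar>Re z\<bar> \<le> X \<Longrightarrow> \<bar>Im z\<bar> \<le> X \<Longrightarrow> bessel_energy \<nu> z \<le> M"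
    unfolding bdd_above_def in_cbox_complex_iff by (force simp: in_cbox_complex_iff)
  have M0: "M \<ge> 0"
    using order_trans[OF bessel_energy_nonneg[of \<nu> 0] M[of 0]] X1 by simp
  define W where "W z = exp ((1 + \<delta>) * \<bar>Im z\<bar>)" for z
  have W2: "exp ((2 + 2 * \<delta>) * \<bar>Im z\<bar>) = (W z)\<^sup>2" for z
    by (simp add: W_def power2_eq_square flip: exp_add)
  have dir: "\<exists>d. norm d = 1 \<and> Re d = 0 \<and> Im z = \<bar>Im z\<bar> * Im d \<and> \<bar>Im d\<bar> = 1" for z
    by (rule exI[of _ "if Im z \<ge> 0 then \<i> else - \<i>"]) auto
  have right: "bessel_energy \<nu> z \<le> C * (Re z powr p)\<^sup>2 * (W z)\<^sup>2" if "Re z \<ge> X" for z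
  proof -
    obtain d where d: "norm d = 1" "Re d = 0" "Im z = \<bar>Im z\<bar> * Im d" "\<bar>Im d\<bar> = 1"
      using dir by blast
    have z: "z = of_real (Re z) + of_real \<bar>Im z\<bar> * d"
      using d by (simp add: complex_eq_iff)
    have "bessel_energy \<nu> (of_real (Re z) + of_real \<bar>Im z\<bar> * d)
        \<le> bessel_energy \<nu> (of_real (Re z)) * exp ((2 + 2 * \<delta>) * \<bar>Im z\<bar>)"
    proof (rule bessel_energy_ray_le[OF d(1) assms])
      fix s
      have "X \<le> norm (of_real (Re z) + of_real s * d)"
        using abs_Re_le_cmod[of "of_real (Re z) + of_real s * d"] that X1 d by simp
      then show "of_real (Re z) + of_real s * d \<noteq> 0 \<and>
          norm (2 * \<nu> + 1) \<le> \<delta> * norm (of_real (Re z) + of_real s * d)"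
        by (rule far)
    qed simp
    also have "\<dots> \<le> C * (Re z powr p)\<^sup>2 * exp ((2 + 2 * \<delta>) * \<bar>Im z\<bar>)"
      using C that X1 by (intro mult_right_mono) auto
    finally show ?thesis
      using z W2 by simp
  qed
  have outer: "bessel_energy \<nu> z \<le> C * (\<bar>Re z\<bar> powr p)\<^sup>2 * (W z)\<^sup>2" if "\<bar>Re z\<bar> \<ge> X" for z
    using right[of z] right[of "- z"] that by (cases "Re z \<ge> 0") (auto simp: W_def)
  have inner: "bessel_energy \<nu> z \<le> M * (W z)\<^sup>2" if "\<bar>Re z\<bar> \<le> X" for z
  proof (cases "\<bar>Im z\<bar> \<le> X")
    case True
    have "M * 1 \<le> M * (W z)\<^sup>2"
      using M0 assms by (intro mult_left_mono) (auto simp flip: W2)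
    then show ?thesis
      using M[OF that True] by simp
  next
    case False
    obtain d where d: "norm d = 1" "Re d = 0" "Im z = \<bar>Im z\<bar> * Im d" "\<bar>Im d\<bar> = 1"
      using dir by blast
    define z0 where "z0 = of_real (Re z) + of_real X * d"
    have z: "z = z0 + of_real (\<bar>Im z\<bar> - X) * d"
      using d by (simp add: complex_eq_iff z0_def algebra_simps)
    have "bessel_energy \<nu> (z0 + of_real (\<bar>Im z\<bar> - X) * d)
        \<le> bessel_energy \<nu> z0 * exp ((2 + 2 * \<delta>) * (\<bar>Im z\<bar> - X))"
    proof (rule bessel_energy_ray_le[OF d(1) assms])
      fix s assume "s \<in> {0..\<bar>Im z\<bar> - X}"
      then have "X \<le> \<bar>Im (z0 + of_real s * d)\<bar>"
        using d X1 by (simp add: z0_def abs_mult flip: distrib_right)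
      then have "X \<le> norm (z0 + of_real s * d)"
        using abs_Im_le_cmod order_trans by blast
      then show "z0 + of_real s * d \<noteq> 0 \<and> norm (2 * \<nu> + 1) \<le> \<delta> * norm (z0 + of_real s * d)"
        by (rule far)
    qed (use False in simp)
    also have "\<dots> \<le> M * exp ((2 + 2 * \<delta>) * \<bar>Im z\<bar>)"
    proof (intro mult_mono)
      show "bessel_energy \<nu> z0 \<le> M"
        using d that X1 by (intro M) (auto simp: z0_def abs_mult)
      show "exp ((2 + 2 * \<delta>) * (\<bar>Im z\<bar> - X)) \<le> exp ((2 + 2 * \<delta>) * \<bar>Im z\<bar>)"
        using assms X1 by simp
    qed (use M0 in auto)
    finally show ?thesis
      using z W2 by simp
  qed
  define L where "L = (sqrt C + sqrt M) * (2 * X) powr \<bar>p\<bar>"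
  have "norm (bessel_even \<nu> z) \<le> L * (1 + \<bar>Re z\<bar>) powr p * W z" for z
  proof (cases "\<bar>Re z\<bar> \<ge> X")
    case True
    have "\<bar>Re z\<bar> powr p \<le> (2 * X) powr \<bar>p\<bar> * (1 + \<bar>Re z\<bar>) powr p"
    proof (rule powr_le_powr_comparable)
      show "\<bar>Re z\<bar> \<le> 2 * X * (1 + \<bar>Re z\<bar>)"
        using mult_mono[of 1 "2 * X" "\<bar>Re z\<bar>" "1 + \<bar>Re z\<bar>"] X1 by simp
      show "1 + \<bar>Re z\<bar> \<le> 2 * X * \<bar>Re z\<bar>"
        using mult_mono[of 2 "2 * X" "\<bar>Re z\<bar>" "\<bar>Re z\<bar>"] X1 True by simp
    qed (use X1 True in auto)
    then have le: "sqrt C * \<bar>Re z\<bar> powr p \<le> L * (1 + \<bar>Re z\<bar>) powr p"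
      unfolding L_def using C(1) M0
      by (smt (verit, ccfv_SIG) mult.assoc mult_mono' powr_ge_zero real_sqrt_ge_zero mult_nonneg_nonneg)
    have "norm (bessel_even \<nu> z) \<le> sqrt (C * (\<bar>Re z\<bar> powr p)\<^sup>2 * (W z)\<^sup>2)"
      by (rule order_trans[OF norm_bessel_even_le real_sqrt_le_mono[OF outer[OF True]]])
    also have "\<dots> = sqrt C * \<bar>Re z\<bar> powr p * W z"
      by (simp add: real_sqrt_mult W_def)
    also have "\<dots> \<le> L * (1 + \<bar>Re z\<bar>) powr p * W z"
      by (intro mult_right_mono le) (simp add: W_def)
    finally show ?thesis .
  next
    case False
    have "1 powr p \<le> (2 * X) powr \<bar>p\<bar> * (1 + \<bar>Re z\<bar>) powr p"
    proof (rule powr_le_powr_comparable)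
      show "1 \<le> 2 * X * (1 + \<bar>Re z\<bar>)"
        using mult_mono[of 1 "2 * X" 1 "1 + \<bar>Re z\<bar>"] X1 by simp
    qed (use X1 False in auto)
    then have le: "sqrt M \<le> L * (1 + \<bar>Re z\<bar>) powr p"
      using mult_mono[of "sqrt M" "sqrt C + sqrt M" 1 "(2 * X) powr \<bar>p\<bar> * (1 + \<bar>Re z\<bar>) powr p"] C(1) M0
      by (simp add: L_def mult.assoc)
    have "norm (bessel_even \<nu> z) \<le> sqrt (M * (W z)\<^sup>2)"
      using False by (intro order_trans[OF norm_bessel_even_le real_sqrt_le_mono[OF inner]]) auto
    also have "\<dots> = sqrt M * W z"
      by (simp add: real_sqrt_mult W_def)
    also have "\<dots> \<le> L * (1 + \<bar>Re z\<bar>) powr p * W z"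
      by (intro mult_right_mono le) (simp add: W_def)
    finally show ?thesis .
  qed
  moreover have "L \<ge> 0"
    using C(1) M0 by (simp add: L_def)
  ultimately show ?thesis
    unfolding p_def W_def by blast
qed

section \<open>Summation by residues\<close>

text \<open>
  With \<open>s = 1\<close> the kernel decays in the lower half plane, with \<open>s = - 1\<close> in the upper one.
\<close>

definition summation_kernel :: "real \<Rightarrow> complex \<Rightarrow> complex" where
  "summation_kernel s z = 1 / (exp (of_real (2 * pi * s) * \<i> * z) - 1)"

lemma exp_two_pi_i_eq_1_iff: "exp (of_real (2 * pi) * \<i> * z) = 1 \<longleftrightarrow> z \<in> \<int>"
proof
  assume "exp (of_real (2 * pi) * \<i> * z) = 1"
  then obtain n :: int where n: "Im z = 0" "2 * pi * Re z = of_int (2 * n) * pi"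
    by (auto simp: exp_eq_1)
  then have "Re z = of_int n" by simp
  then have "z = of_int n"
    using n(1) by (simp add: complex_eq_iff)
  then show "z \<in> \<int>" by simp
next
  assume "z \<in> \<int>"
  then obtain n :: int where "z = of_int n" by (rule Ints_cases)
  then show "exp (of_real (2 * pi) * \<i> * z) = 1"
    by (auto simp: exp_eq_1)
qed

text \<open>
  Crossing the real axis replaces the kernel that decays below by the one that decays above, at the cost
  of the constant \<open>- 1\<close>; this constant is what produces the integral of \<open>F\<close>.
\<close>

lemma summation_kernel_reflect:
  assumes "z \<notin> \<int>"
  shows "summation_kernel 1 z = - 1 - summation_kernel (- 1) z"
proof -
  define w where "w = exp (of_real (2 * pi) * \<i> * z)"
  have w: "w \<noteq> 1" "w \<noteq> 0"
    using assms exp_two_pi_i_eq_1_iff[of z] by (auto simp: w_def)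
  have "1 / (w - 1) = - 1 - 1 / (inverse w - 1)"
    using w by (simp add: field_simps)
  then show ?thesis
    by (simp add: summation_kernel_def w_def exp_minus)
qed

text \<open>
  On the lines \<open>Re z = N + 1/2\<close> the exponential is a negative real number, so no cancellation occurs in the
  denominator, even where the line meets the real axis.
\<close>

lemma norm_summation_kernel_half_integer:
  fixes N :: int
  assumes "Re z = of_int N + 1/2" and "\<bar>s\<bar> = 1" and "s * Im z \<le> 0"
  shows "norm (summation_kernel s z) \<le> exp (- (2 * pi * \<bar>Im z\<bar>))"
proof -
  have s: "s = 1 \<or> s = -1" using assms(2) by linarith
  have im: "s * Im z = - \<bar>Im z\<bar>" using s assms(3) by auto
  have "of_real (2 * pi * s) * \<i> * z =
      of_real (2 * pi * \<bar>Im z\<bar>) + (of_int (if s = 1 then N else - N - 1) * (of_real (2 * pi) * \<i>) + of_real pi * \<i>)"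
    using s im assms(1) by (auto simp: complex_eq_iff algebra_simps)
  moreover have "exp (of_int n * (of_real (2 * pi) * \<i>) + of_real pi * \<i>) = -1" for n
  proof -
    have "exp (of_int n * (of_real (2 * pi) * \<i>)) = 1"
      by (auto simp: exp_eq_1)
    then show ?thesis
      by (simp add: exp_add)
  qed
  ultimately have "exp (of_real (2 * pi * s) * \<i> * z) - 1 = - of_real (exp (2 * pi * \<bar>Im z\<bar>) + 1)"
    by (simp only: exp_add exp_of_real) simp
  then have "norm (exp (of_real (2 * pi * s) * \<i> * z) - 1) = exp (2 * pi * \<bar>Im z\<bar>) + 1"
    by (simp only: norm_minus_cancel norm_of_real) simp
  then have "norm (summation_kernel s z) = 1 / (exp (2 * pi * \<bar>Im z\<bar>) + 1)"
    by (simp add: summation_kernel_def norm_divide)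
  also have "\<dots> \<le> 1 / exp (2 * pi * \<bar>Im z\<bar>)"
    by (intro frac_le) auto
  finally show ?thesis
    by (simp add: exp_minus inverse_eq_divide)
qed

lemma norm_summation_kernel_high:
  assumes "s * Im z = - R" and "R \<ge> 1"
  shows "norm (summation_kernel s z) \<le> 2 * exp (- (2 * pi * R))"
proof -
  have "2 * pi * s * Im z = - (2 * pi * R)"
    using assms(1) by (simp add: mult.assoc)
  then have "norm (exp (of_real (2 * pi * s) * \<i> * z)) = exp (2 * pi * R)"
    by simp
  then have 1: "norm (exp (of_real (2 * pi * s) * \<i> * z) - 1) \<ge> exp (2 * pi * R) - 1"
    using norm_triangle_ineq2[of "exp (of_real (2 * pi * s) * \<i> * z)" 1] by (simp only: norm_one)
  have "2 * pi * R \<ge> 2 * 1 * 1"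
    using assms(2) pi_ge_two by (intro mult_mono) auto
  then have "exp (2 * pi * R) \<ge> 2"
    using exp_ge_add_one_self[of "2 * pi * R"] by linarith
  then have 2: "exp (2 * pi * R) - 1 \<ge> exp (2 * pi * R) / 2" by simp
  have "norm (summation_kernel s z) = 1 / norm (exp (of_real (2 * pi * s) * \<i> * z) - 1)"
    by (simp add: summation_kernel_def norm_divide)
  also have "\<dots> \<le> 1 / (exp (2 * pi * R) / 2)"
    by (rule frac_le[OF _ order_refl _ order_trans[OF 2 1]]) auto
  finally show ?thesis
    by (simp add: exp_minus inverse_eq_divide)
qed

lemma residue_summation_kernel:
  assumes F: "F holomorphic_on UNIV"
  shows "residue (\<lambda>z. F z * summation_kernel 1 z) (of_int n) = F (of_int n) / (of_real (2 * pi) * \<i>)"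
proof (rule residue_simple')
  let ?e = "\<lambda>z. exp (of_real (2 * pi) * \<i> * z)"
  show "open (ball (of_int n) 1 :: complex set)" "of_int n \<in> (ball (of_int n) 1 :: complex set)"
    by auto
  have "z \<notin> \<int>" if "z \<in> ball (of_int n) 1 - {of_int n}" for z :: complex
  proof
    assume "z \<in> \<int>"
    then obtain m where "z = of_int m" by (rule Ints_cases)
    then have "\<bar>real_of_int (n - m)\<bar> < 1" "m \<noteq> n"
      using that by (auto simp: dist_of_int)
    then show False by linarith
  qed
  then show "(\<lambda>z. F z * summation_kernel 1 z) holomorphic_on ball (of_int n) 1 - {of_int n}"
    unfolding summation_kernel_def
    by (intro holomorphic_intros holomorphic_on_subset[OF F]) (use exp_two_pi_i_eq_1_iff in auto)
  have 1: "(F \<longlongrightarrow> F (of_int n)) (at (of_int n))"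
    using holomorphic_on_imp_continuous_on[OF F] by (simp add: continuous_on_eq_continuous_at isCont_def)
  have "(?e has_field_derivative of_real (2 * pi) * \<i> * ?e (of_int n)) (at (of_int n))"
    by (auto intro!: derivative_eq_intros)
  moreover have e1: "?e (of_int n) = 1"
    unfolding exp_two_pi_i_eq_1_iff by simp
  ultimately have 2: "((\<lambda>w. (?e w - 1) / (w - of_int n)) \<longlongrightarrow> of_real (2 * pi) * \<i>) (at (of_int n))"
    by (simp add: has_field_derivative_iff)
  have "((\<lambda>w. F w / ((?e w - 1) / (w - of_int n))) \<longlongrightarrow> F (of_int n) / (of_real (2 * pi) * \<i>)) (at (of_int n))"
    by (intro tendsto_divide 1 2) auto
  then show "((\<lambda>w. F w * summation_kernel 1 w * (w - of_int n)) \<longlongrightarrow> F (of_int n) / (of_real (2 * pi) * \<i>)) (at (of_int n))"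
    by (simp add: summation_kernel_def)
qed

text \<open>
  The quantitative form of the contour argument for the rectangle with half-width \<open>X\<close> and half-height
  \<open>R\<close>: each of the four vertical half-sides contributes at most \<open>m R\<close>, each horizontal side at most \<open>4 h X\<close>.
\<close>

lemma sum_minus_integral_bound:
  fixes F :: "complex \<Rightarrow> complex" and N :: nat and R m h :: real
  defines "X \<equiv> real N + 1/2"
  assumes F: "F holomorphic_on UNIV" and R: "R \<ge> 1"
    and vert: "\<And>z. \<bar>Re z\<bar> = X \<Longrightarrow> norm (F z) \<le> m * exp (2 * pi * \<bar>Im z\<bar>)"
    and horiz: "\<And>z. \<bar>Im z\<bar> = R \<Longrightarrow> norm (F z) \<le> h * exp (2 * pi * R)"
  shows "norm ((\<Sum>n\<in>{- int N..int N}. F (of_int n)) - integral {-X..X} (\<lambda>x. F (of_real x)))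
           \<le> 4 * m * R + 8 * h * X"
proof -
  have X: "X > 0" by (simp add: X_def)
  have m0: "m \<ge> 0"
  proof -
    have "0 \<le> m * exp (2 * pi * \<bar>Im (of_real X)\<bar>)"
      by (rule order_trans[OF norm_ge_zero vert]) (use X in simp)
    then show ?thesis by simp
  qed
  have h0: "h \<ge> 0"
  proof -
    have "0 \<le> h * exp (2 * pi * R)"
      by (rule order_trans[OF norm_ge_zero horiz[of "Complex 0 R"]]) (use R in simp)
    then show ?thesis by (simp add: zero_le_mult_iff)
  qed
  define f g where "f = (\<lambda>z. F z * summation_kernel 1 z)" and "g = (\<lambda>z. F z * summation_kernel (-1) z)"
  \<comment> \<open>The corners, counterclockwise from the lower left, and the midpoints of the vertical sides.\<close>
  define A B C D E W where "A = Complex (-X) (-R)" and "B = Complex X (-R)" and "C = Complex X R"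
    and "D = Complex (-X) R" and "E = Complex X 0" and "W = Complex (-X) 0"
  note pts = A_def B_def C_def D_def E_def W_def
  \<comment> \<open>Two grid lines in each direction; all segments of the contour lie on them, away from the integers.\<close>
  define Q where "Q = {z. \<bar>Re z\<bar> = X} \<union> {z. \<bar>Im z\<bar> = R}"
  have QZ: "z \<notin> \<int>" if "z \<in> Q" for z
  proof
    assume "z \<in> \<int>"
    then obtain k where k: "z = of_int k" by (rule Ints_cases)
    have "\<bar>of_int k\<bar> \<noteq> X"
    proof
      assume "\<bar>of_int k\<bar> = X"
      then have "real_of_int (2 * \<bar>k\<bar>) = real_of_int (2 * int N + 1)"
        by (simp add: X_def)
      then have "2 * \<bar>k\<bar> = 2 * int N + 1" by linarith
      then show False by presburger
    qed
    then show False
      using that R k by (auto simp: Q_def)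
  qed
  have seg: "closed_segment A B \<subseteq> Q" "closed_segment B E \<subseteq> Q" "closed_segment E C \<subseteq> Q"
      "closed_segment C D \<subseteq> Q" "closed_segment D W \<subseteq> Q" "closed_segment W A \<subseteq> Q"
      "closed_segment B C \<subseteq> Q" "closed_segment D A \<subseteq> Q"
    using X R by (auto simp: pts Q_def closed_segment_same_Re closed_segment_same_Im)
  have eQ: "exp (of_real (2 * pi) * \<i> * z) \<noteq> 1" "exp (- (of_real (2 * pi) * \<i> * z)) \<noteq> 1" if "z \<in> Q" for z
    using QZ[OF that] exp_two_pi_i_eq_1_iff[of z] exp_two_pi_i_eq_1_iff[of "- z"]
    by (auto simp: minus_in_Ints_iff)
  have contF: "continuous_on S F" for S
    using holomorphic_on_imp_continuous_on[OF F] continuous_on_subset by blast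
  have cf: "continuous_on Q f" and cg: "continuous_on Q g"
    unfolding f_def g_def summation_kernel_def
    by (intro continuous_intros contF; use eQ in simp)+
  have If: "f contour_integrable_on linepath p q" and Ig: "g contour_integrable_on linepath p q"
    if "closed_segment p q \<subseteq> Q" for p q
    using that by (auto intro!: contour_integrable_continuous_linepath continuous_on_subset[OF cf] continuous_on_subset[OF cg])

  let ?I = "\<lambda>p q f. contour_integral (linepath p q) f"
  have res: "contour_integral (rectpath A C) f = (\<Sum>n\<in>{- int N..int N}. F (of_int n))"
  proof -
    define S where "S = {z. - (real N + 1) < Re z} \<inter> {z. Re z < real N + 1}"
    define P where "P = (of_int ` {- int N..int N} :: complex set)"
    have "contour_integral (rectpath A C) f =
        2 * pi * \<i> * (\<Sum>p\<in>P. winding_number (rectpath A C) p * residue f p)"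
    proof (rule Residue_theorem)
      show "open S"
        unfolding S_def by (intro open_Int open_halfspace_Re_gt open_halfspace_Re_lt)
      show "connected S"
        unfolding S_def by (intro convex_connected convex_Int convex_halfspace_Re_gt convex_halfspace_Re_lt)
      show "finite P" by (simp add: P_def)
      have SP: "z \<notin> \<int>" if "z \<in> S - P" for z
      proof
        assume "z \<in> \<int>"
        then obtain k where k: "z = of_int k" by (rule Ints_cases)
        with that have "k \<notin> {- int N..int N}" "- (real N + 1) < of_int k" "of_int k < real N + 1"
          by (auto simp: S_def P_def)
        then show False by simp
      qed
      show "f holomorphic_on S - P"
        unfolding f_def summation_kernel_def
        by (intro holomorphic_intros holomorphic_on_subset[OF F]) (use SP exp_two_pi_i_eq_1_iff in auto)
      have "path_image (rectpath A C) \<subseteq> Q \<inter> S"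
        using X R by (subst path_image_rectpath) (auto simp: pts Q_def S_def X_def)
      moreover have "P \<subseteq> \<int>" by (auto simp: P_def)
      ultimately show "path_image (rectpath A C) \<subseteq> S - P"
        using QZ by blast
      show "\<forall>z. z \<notin> S \<longrightarrow> winding_number (rectpath A C) z = 0"
        using X R by (auto intro!: winding_number_rectpath_outside simp: pts S_def X_def in_cbox_complex_iff)
    qed auto
    also have "(\<Sum>p\<in>P. winding_number (rectpath A C) p * residue f p) =
        (\<Sum>p\<in>P. F p / (of_real (2 * pi) * \<i>))"
    proof (rule sum.cong)
      fix p assume "p \<in> P"
      then obtain n where n: "n \<in> {- int N..int N}" "p = of_int n" by (auto simp: P_def)
      then have "real_of_int n \<le> real N" "- real N \<le> real_of_int n" by auto
      then have "winding_number (rectpath A C) p = 1"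
        using n(2) R by (intro winding_number_rectpath) (auto simp: pts X_def in_box_complex_iff)
      then show "winding_number (rectpath A C) p * residue f p = F p / (of_real (2 * pi) * \<i>)"
        unfolding f_def n(2) residue_summation_kernel[OF F] by simp
    qed simp
    also have "\<dots> = (\<Sum>n\<in>{- int N..int N}. F (of_int n) / (of_real (2 * pi) * \<i>))"
      unfolding P_def by (subst sum.reindex) (auto intro: inj_onI)
    finally show ?thesis
      by (simp flip: sum_divide_distrib)
  qed
  have split: "contour_integral (rectpath A C) f =
      ?I A B f + (?I B E f + ?I E C f) + ?I C D f + (?I D W f + ?I W A f)"
  proof -
    have "Complex (Re C) (Im A) = B" "Complex (Re A) (Im C) = D" by (auto simp: pts)
    then have "contour_integral (rectpath A C) f = ?I A B f + (?I B C f + (?I C D f + ?I D A f))"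
      unfolding rectpath_def Let_def by (simp add: If seg contour_integrable_joinI)
    moreover have "?I B C f = ?I B E f + ?I E C f"
      using R by (intro contour_integral_split_linepath continuous_on_subset[OF cf] seg)
         (auto simp: pts closed_segment_same_Re closed_segment_eq_real_ivl)
    moreover have "?I D A f = ?I D W f + ?I W A f"
      using R by (intro contour_integral_split_linepath continuous_on_subset[OF cf] seg)
         (auto simp: pts closed_segment_same_Re closed_segment_eq_real_ivl)
    ultimately show ?thesis by simp
  qed
  \<comment> \<open>A primitive of \<open>F\<close> evaluates the contribution of the constant \<open>- 1\<close> on the three upper segments,
    which together lead from \<open>E\<close> to \<open>W\<close>.\<close>
  obtain P where P: "\<And>z. (P has_field_derivative F z) (at z)"
    using holomorphic_convex_primitive'[OF convex_UNIV open_UNIV F] by auto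
  have prim: "(F has_contour_integral (P q - P p)) (linepath p q)" for p q
    using contour_integral_primitive[of UNIV P F "linepath p q"] P by simp
  have up: "?I p q f = P p - P q - ?I p q g" if "closed_segment p q \<subseteq> Q" for p q
  proof -
    have "((\<lambda>z. - F z - g z) has_contour_integral (- (P q - P p) - ?I p q g)) (linepath p q)"
      by (intro has_contour_integral_diff has_contour_integral_neg prim has_contour_integral_integral Ig that)
    then have "(f has_contour_integral (- (P q - P p) - ?I p q g)) (linepath p q)"
    proof (rule has_contour_integral_eq)
      fix z assume "z \<in> path_image (linepath p q)"
      then have "z \<notin> \<int>" using that QZ by auto
      then show "- F z - g z = f z"
        by (simp add: f_def g_def summation_kernel_reflect algebra_simps)
    qed
    then show ?thesis
      by (simp add: contour_integral_unique)
  qed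
  have int: "integral {-X..X} (\<lambda>x. F (of_real x)) = P E - P W"
  proof -
    have "?I W E F = integral {Re W..Re E} (\<lambda>x. F (of_real x))"
      using X by (intro contour_integral_linepath_Reals_eq) (auto simp: pts complex_is_Real_iff)
    then show ?thesis
      using contour_integral_unique[OF prim[of E W]] by (simp add: pts)
  qed
  have eq: "(\<Sum>n\<in>{- int N..int N}. F (of_int n)) - integral {-X..X} (\<lambda>x. F (of_real x)) =
      (?I A B f + ?I B E f + ?I W A f) - (?I E C g + ?I C D g + ?I D W g)"
    unfolding res[symmetric] split int by (simp add: up seg)
  have vb: "norm (F z * summation_kernel s z) \<le> m"
    if "\<bar>Re z\<bar> = X" "\<bar>s\<bar> = 1" "s * Im z \<le> 0" for s z
  proof -
    have "Re z = of_int (int N) + 1/2 \<or> Re z = of_int (- int N - 1) + 1/2"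
      using that(1) by (auto simp: X_def abs_if split: if_splits)
    then have "norm (summation_kernel s z) \<le> exp (- (2 * pi * \<bar>Im z\<bar>))"
      using norm_summation_kernel_half_integer that by blast
    then have "norm (F z) * norm (summation_kernel s z)
        \<le> (m * exp (2 * pi * \<bar>Im z\<bar>)) * exp (- (2 * pi * \<bar>Im z\<bar>))"
      using m0 by (intro mult_mono vert that) auto
    also have "\<dots> = m * (exp (2 * pi * \<bar>Im z\<bar>) * exp (- (2 * pi * \<bar>Im z\<bar>)))"
      by (simp only: mult.assoc)
    finally show ?thesis
      by (simp add: norm_mult flip: exp_add)
  qed
  have hb: "norm (F z * summation_kernel s z) \<le> 2 * h" if "\<bar>Im z\<bar> = R" "s * Im z = - R" for s z
  proof -
    have "norm (F z) * norm (summation_kernel s z) \<le> (h * exp (2 * pi * R)) * (2 * exp (- (2 * pi * R)))"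
      using h0 by (intro mult_mono horiz norm_summation_kernel_high that R) auto
    also have "\<dots> = 2 * h * (exp (2 * pi * R) * exp (- (2 * pi * R)))"
      by (simp only: mult_ac)
    finally show ?thesis
      by (simp add: norm_mult flip: exp_add)
  qed
  have vI: "norm (?I p q f) \<le> m * R" "norm (?I q p f) \<le> m * R"
    if "p = W \<and> q = A \<or> p = E \<and> q = B" for p q
  proof -
    have "norm (f z) \<le> m" if "z \<in> closed_segment p q" for z
      unfolding f_def using that \<open>p = W \<and> q = A \<or> p = E \<and> q = B\<close> R X
      by (intro vb) (auto simp: pts closed_segment_same_Re closed_segment_eq_real_ivl)
    then have "norm (?I p q f) \<le> m * norm (q - p)" "norm (?I q p f) \<le> m * norm (p - q)"
      using that seg by (intro contour_integral_bound_linepath If m0; auto simp: closed_segment_commute)+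
    then show "norm (?I p q f) \<le> m * R" "norm (?I q p f) \<le> m * R"
      using that R by (auto simp: pts cmod_def)
  qed
  have vI': "norm (?I p q g) \<le> m * R" "norm (?I q p g) \<le> m * R"
    if "p = W \<and> q = D \<or> p = E \<and> q = C" for p q
  proof -
    have "norm (g z) \<le> m" if "z \<in> closed_segment p q" for z
      unfolding g_def using that \<open>p = W \<and> q = D \<or> p = E \<and> q = C\<close> R X
      by (intro vb) (auto simp: pts closed_segment_same_Re closed_segment_eq_real_ivl)
    then have "norm (?I p q g) \<le> m * norm (q - p)" "norm (?I q p g) \<le> m * norm (p - q)"
      using that seg by (intro contour_integral_bound_linepath Ig m0; auto simp: closed_segment_commute)+
    then show "norm (?I p q g) \<le> m * R" "norm (?I q p g) \<le> m * R"
      using that R by (auto simp: pts cmod_def)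
  qed
  have hI: "norm (?I A B f) \<le> 4 * h * X"
  proof -
    have "norm (?I A B f) \<le> (2 * h) * norm (B - A)"
      unfolding f_def using h0 R seg X
      by (intro contour_integral_bound_linepath If[unfolded f_def] hb)
         (auto simp: pts closed_segment_same_Im)
    moreover have "B - A = of_real (2 * X)"
      by (simp add: pts complex_eq_iff)
    then have "norm (B - A) = 2 * X"
      using X by (simp only: norm_of_real)
    ultimately show ?thesis by simp
  qed
  have hI': "norm (?I C D g) \<le> 4 * h * X"
  proof -
    have "norm (?I C D g) \<le> (2 * h) * norm (D - C)"
      unfolding g_def using h0 R seg X
      by (intro contour_integral_bound_linepath Ig[unfolded g_def] hb)
         (auto simp: pts closed_segment_same_Im)
    moreover have "D - C = of_real (- (2 * X))"
      by (simp add: pts complex_eq_iff)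
    then have "norm (D - C) = 2 * X"
      using X by (simp only: norm_of_real)
    ultimately show ?thesis by simp
  qed
  show ?thesis
    unfolding eq
    by (rule order_trans[OF norm_triangle_ineq4])
       (use norm_triangle_ineq[of "?I A B f + ?I B E f" "?I W A f"] norm_triangle_ineq[of "?I A B f" "?I B E f"]
          norm_triangle_ineq[of "?I E C g + ?I C D g" "?I D W g"] norm_triangle_ineq[of "?I E C g" "?I C D g"]
          vI(1)[of W A] vI(2)[of E B] vI'(1)[of E C] vI'(2)[of W D] hI hI' in simp)
qed

text \<open>
  The half-height \<open>R = (N + 1)\<^sup>\<epsilon>\<^sup>/\<^sup>2\<close> balances the two errors: it grows slowly enough for the decay
  \<open>N\<^sup>-\<^sup>\<epsilon>\<close> on the vertical sides to win, and fast enough for \<open>exp ((c - 2 \<pi>) R)\<close> to beat the length of the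
  horizontal ones.
\<close>

lemma sum_minus_integral_tendsto_0:
  fixes F :: "complex \<Rightarrow> complex" and C c \<epsilon> :: real
  assumes F: "F holomorphic_on UNIV" and "\<epsilon> > 0" and "c < 2 * pi"
    and bound: "\<And>z. norm (F z) \<le> C * (1 + \<bar>Re z\<bar>) powr (- \<epsilon>) * exp (c * \<bar>Im z\<bar>)"
  shows "(\<lambda>N. (\<Sum>n\<in>{- int N..int N}. F (of_int n))
            - integral {- (real N + 1/2)..real N + 1/2} (\<lambda>x. F (of_real x))) \<longlonglongrightarrow> 0"
proof (rule Lim_null_comparison)
  have C: "C \<ge> 0"
    using order_trans[OF norm_ge_zero bound[of 0]] by simp
  define R where "R N = (real N + 1) powr (\<epsilon> / 2)" for N
  let ?B = "\<lambda>N. 4 * (C * (real N + 3/2) powr (- \<epsilon>)) * R N + 8 * (C * exp ((c - 2 * pi) * R N)) * (real N + 1/2)"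
  show "\<forall>\<^sub>F N in sequentially. norm ((\<Sum>n\<in>{- int N..int N}. F (of_int n))
            - integral {- (real N + 1/2)..real N + 1/2} (\<lambda>x. F (of_real x))) \<le> ?B N"
  proof (intro always_eventually allI sum_minus_integral_bound F)
    fix N
    show R1: "R N \<ge> 1"
      unfolding R_def using \<open>\<epsilon> > 0\<close> by (intro ge_one_powr_ge_zero) auto
    show "norm (F z) \<le> C * (real N + 3/2) powr (- \<epsilon>) * exp (2 * pi * \<bar>Im z\<bar>)"
      if "\<bar>Re z\<bar> = real N + 1/2" for z
    proof -
      have "1 + \<bar>Re z\<bar> = real N + 3/2" using that by simp
      then have "norm (F z) \<le> C * (real N + 3/2) powr (- \<epsilon>) * exp (c * \<bar>Im z\<bar>)"
        using bound[of z] by simp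
      also have "\<dots> \<le> C * (real N + 3/2) powr (- \<epsilon>) * exp (2 * pi * \<bar>Im z\<bar>)"
        using C \<open>c < 2 * pi\<close> by (intro mult_left_mono) (auto intro!: mult_right_mono)
      finally show ?thesis .
    qed
    show "norm (F z) \<le> C * exp ((c - 2 * pi) * R N) * exp (2 * pi * R N)" if "\<bar>Im z\<bar> = R N" for z
    proof -
      have "norm (F z) \<le> C * (1 + \<bar>Re z\<bar>) powr (- \<epsilon>) * exp (c * \<bar>Im z\<bar>)"
        by (rule bound)
      also have "\<dots> \<le> C * 1 * exp (c * \<bar>Im z\<bar>)"
        using C \<open>\<epsilon> > 0\<close> powr_mono2'[of "- \<epsilon>" 1 "1 + \<bar>Re z\<bar>"]
        by (intro mult_right_mono mult_left_mono) auto
      also have "\<dots> = C * exp ((c - 2 * pi) * R N) * exp (2 * pi * R N)"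
        using that by (simp add: algebra_simps flip: exp_add)
      finally show ?thesis .
    qed
  qed
  define d where "d = 2 * pi - c"
  have "d > 0" using assms by (simp add: d_def)
  have "?B = (\<lambda>N. 4 * (C * (real N + 3/2) powr (- \<epsilon>)) * (real N + 1) powr (\<epsilon> / 2)
      + 8 * (C * exp (- d * (real N + 1) powr (\<epsilon> / 2))) * (real N + 1/2))"
    by (simp add: R_def d_def)
  also have "\<dots> \<longlonglongrightarrow> 0"
    using \<open>d > 0\<close> \<open>\<epsilon> > 0\<close> by real_asymp
  finally show "?B \<longlonglongrightarrow> 0" .
qed

text \<open>
  Evenness folds both the two-sided sum and the two-sided integral onto the half-line, which is where the
  weight \<open>1/2\<close> of the term at \<open>0\<close> comes from. The sum inherits convergence from the integral because their
  difference tends to \<open>0\<close>.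
\<close>

lemma even_sums_integral:
  fixes F :: "complex \<Rightarrow> complex" and C c \<epsilon> :: real
  assumes F: "F holomorphic_on UNIV" and "\<epsilon> > 0" and "c < 2 * pi"
    and bound: "\<And>z. norm (F z) \<le> C * (1 + \<bar>Re z\<bar>) powr (- \<epsilon>) * exp (c * \<bar>Im z\<bar>)"
    and even: "\<And>z. F (- z) = F z"
    and lim: "((\<lambda>T. integral {0..T} (\<lambda>x. F (of_real x))) \<longlongrightarrow> I) at_top"
  shows "(\<lambda>n. neumann_factor n * F (of_nat n)) sums I"
proof -
  define J where "J T = integral {0..T} (\<lambda>x. F (of_real x))" for T
  have contF: "continuous_on A (\<lambda>x::real. F (of_real x))" for A
    by (rule continuous_on_compose2[OF holomorphic_on_imp_continuous_on[OF F]]) (auto intro!: continuous_intros)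
  have int: "integral {- X..X} (\<lambda>x. F (of_real x)) = 2 * J X" if "X \<ge> 0" for X
  proof -
    have "integral {- X..X} (\<lambda>x. F (of_real x))
        = integral {- X..0} (\<lambda>x. F (of_real x)) + integral {0..X} (\<lambda>x. F (of_real x))"
      using that by (intro Henstock_Kurzweil_Integration.integral_combine[symmetric] integrable_continuous_real contF) auto
    also have "integral {- X..0} (\<lambda>x. F (of_real x)) = integral {0..X} (\<lambda>x. F (of_real x))"
      using Henstock_Kurzweil_Integration.integral_reflect_real[of X 0 "\<lambda>x. F (of_real x)"] by (simp add: even)
    finally show ?thesis by (simp add: J_def)
  qed
  have sum: "(\<Sum>n\<in>{- int N..int N}. F (of_int n)) = 2 * (\<Sum>n\<le>N. neumann_factor n * F (of_nat n))" for N
  proof (induction N)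
    case (Suc N)
    have "{- int (Suc N)..int (Suc N)} = insert (- int (Suc N)) (insert (int (Suc N)) {- int N..int N})"
      by auto
    then have "(\<Sum>n\<in>{- int (Suc N)..int (Suc N)}. F (of_int n))
        = F (- of_nat (Suc N)) + (F (of_nat (Suc N)) + (\<Sum>n\<in>{- int N..int N}. F (of_int n)))"
      by simp
    then show ?case
      unfolding even Suc.IH by (simp add: neumann_factor_def algebra_simps)
  qed (simp add: neumann_factor_def)
  have intN: "integral {- (real N + 1/2)..real N + 1/2} (\<lambda>x. F (of_real x)) = 2 * J (real N + 1/2)" for N
    by (rule int) simp
  have "(\<lambda>N. 2 * (\<Sum>n\<le>N. neumann_factor n * F (of_nat n)) - 2 * J (real N + 1/2)) \<longlonglongrightarrow> 0"
    using sum_minus_integral_tendsto_0[OF F assms(2,3) bound] unfolding sum intN .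
  moreover have "filterlim (\<lambda>N. real N + 1/2) at_top sequentially"
    by real_asymp
  then have "(\<lambda>N. J (real N + 1/2)) \<longlonglongrightarrow> I"
    using lim unfolding J_def[abs_def, symmetric] by (rule filterlim_compose[rotated])
  ultimately have "(\<lambda>N. (2 * (\<Sum>n\<le>N. neumann_factor n * F (of_nat n)) - 2 * J (real N + 1/2)) / 2
       + J (real N + 1/2)) \<longlonglongrightarrow> 0 / 2 + I"
    by (intro tendsto_add tendsto_divide) auto
  then show ?thesis
    unfolding sums_def_le by (simp add: diff_divide_distrib)
qed

section \<open>Convergence of the integral\<close>

text \<open>
  The increments of \<open>p\<close> are dominated by those of \<open>- C/\<epsilon> t\<^sup>-\<^sup>\<epsilon>\<close>, so \<open>p\<close> satisfies Cauchy's criterion at infinity.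
\<close>

lemma convergent_of_powr_derivative_bound:
  fixes p p' :: "real \<Rightarrow> 'a::banach"
  assumes "\<epsilon> > 0" and deriv: "\<And>t. t \<ge> 1 \<Longrightarrow> (p has_vector_derivative p' t) (at t)"
    and bound: "\<And>t. t \<ge> 1 \<Longrightarrow> norm (p' t) \<le> C * t powr (- \<epsilon> - 1)"
  shows "\<exists>L. (p \<longlongrightarrow> L) at_top"
proof -
  have C: "C \<ge> 0"
    using order_trans[OF norm_ge_zero bound[of 1]] by simp
  have le: "norm (p t - p s) \<le> C / \<epsilon> * s powr (- \<epsilon>)" if "1 \<le> s" "s < t" for s t
  proof -
    have "norm (p t - p s) \<le> - C / \<epsilon> * t powr (- \<epsilon>) - - C / \<epsilon> * s powr (- \<epsilon>)"
    proof (rule differentiable_bound_general[OF \<open>s < t\<close>])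
      show "continuous_on {s..t} p"
        using that by (intro continuous_at_imp_continuous_on ballI has_vector_derivative_continuous[OF deriv]) auto
      show "continuous_on {s..t} (\<lambda>t. - C / \<epsilon> * t powr (- \<epsilon>))"
        using that by (intro continuous_intros) auto
      fix x assume "s < x" "x < t"
      then have x: "x \<ge> 1" using that by simp
      show "(p has_vector_derivative p' x) (at x)" "norm (p' x) \<le> C * x powr (- \<epsilon> - 1)"
        by (rule deriv[OF x] bound[OF x])+
      show "((\<lambda>t. - C / \<epsilon> * t powr (- \<epsilon>)) has_vector_derivative C * x powr (- \<epsilon> - 1)) (at x)"
        unfolding has_real_derivative_iff_has_vector_derivative[symmetric]
        using x \<open>\<epsilon> > 0\<close> by (auto intro!: derivative_eq_intros simp: powr_diff)
    qed
    moreover have "C / \<epsilon> * t powr (- \<epsilon>) \<ge> 0"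
      using C \<open>\<epsilon> > 0\<close> by simp
    ultimately show ?thesis by simp
  qed
  have "((\<lambda>s. C / \<epsilon> * s powr (- \<epsilon>)) \<longlongrightarrow> 0) at_top"
    using \<open>\<epsilon> > 0\<close> by real_asymp
  then have small: "\<exists>S\<ge>1. C / \<epsilon> * S powr (- \<epsilon>) < e" if "e > 0" for e
    using order_tendstoD(2)[OF _ that] eventually_ge_at_top[of 1]
    by (metis (mono_tags, lifting) eventually_at_top_linorder eventually_conj order_refl)
  have cauchy: "\<exists>S. \<forall>s\<ge>S. \<forall>t\<ge>S. dist (p s) (p t) < e" if "e > 0" for e
  proof -
    have "e / 2 > 0" using that by simp
    from small[OF this] obtain S where S: "S \<ge> 1" "C / \<epsilon> * S powr (- \<epsilon>) < e / 2"
      by blast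
    have near: "dist (p t) (p S) < e / 2" if "t \<ge> S" for t
    proof (cases "t = S")
      case False
      then have "norm (p t - p S) \<le> C / \<epsilon> * S powr (- \<epsilon>)"
        using S(1) that by (intro le) auto
      then show ?thesis
        unfolding dist_norm using S(2) by (rule le_less_trans)
    qed (use \<open>e > 0\<close> in simp)
    have "dist (p s) (p t) < e" if "s \<ge> S" "t \<ge> S" for s t
      using dist_triangle_half_l[OF near[OF that(1)] near[OF that(2)]] .
    then show ?thesis by blast
  qed
  have "cauchy_filter (filtermap p at_top)"
    unfolding cauchy_filter_metric_filtermap
  proof (intro allI impI)
    fix e :: real assume "e > 0"
    from cauchy[OF this] obtain S where "\<forall>s\<ge>S. \<forall>t\<ge>S. dist (p s) (p t) < e"
      by blast
    then show "\<exists>P. eventually P at_top \<and> (\<forall>x y. P x \<and> P y \<longrightarrow> dist (p x) (p y) < e)"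
      by (intro exI[of _ "\<lambda>t. S \<le> t"]) (auto intro: eventually_ge_at_top)
  qed
  then have "convergent_filter (filtermap p at_top)"
    by (rule cauchy_filter_convergent)
  then show ?thesis
    unfolding convergent_filter_iff filterlim_def .
qed

lemma bessel_liouville_scaled_bounded:
  assumes "a > 0"
  obtains C where "\<And>t. t \<ge> 1 \<Longrightarrow> norm (bessel_liouville \<nu> (of_real (a * t))) \<le> C"
    and "\<And>t. t \<ge> 1 \<Longrightarrow> norm (of_real a * bessel_liouville' \<nu> (of_real (a * t))) \<le> C"
proof -
  obtain C where C: "\<And>s. s \<ge> a \<Longrightarrow> norm (bessel_liouville \<nu> (of_real s)) \<le> C"
      "\<And>s. s \<ge> a \<Longrightarrow> norm (bessel_liouville' \<nu> (of_real s)) \<le> C"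
    using bessel_liouville_bounded[OF assms, of \<nu>] by blast
  have C0: "C \<ge> 0"
    using order_trans[OF norm_ge_zero C(1)[of a]] by simp
  have le: "a \<le> a * t" if "t \<ge> 1" for t
    using mult_left_mono[OF that, of a] assms by simp
  show thesis
  proof (rule that)
    fix t :: real assume t: "t \<ge> 1"
    have "norm (bessel_liouville \<nu> (of_real (a * t))) \<le> C * 1"
      using C(1)[OF le[OF t]] by simp
    also have "\<dots> \<le> C * (1 + a)"
      using C0 assms by (intro mult_left_mono) auto
    finally show "norm (bessel_liouville \<nu> (of_real (a * t))) \<le> C * (1 + a)" .
    have "norm (of_real a * bessel_liouville' \<nu> (of_real (a * t))) \<le> (1 + a) * C"
      unfolding norm_mult using assms by (intro mult_mono C(2) le[OF t]) auto
    then show "norm (of_real a * bessel_liouville' \<nu> (of_real (a * t))) \<le> C * (1 + a)"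
      by (simp only: mult.commute)
  qed
qed

lemma has_vector_derivative_liouville_scaled:
  assumes "a > 0" "t > 0"
  shows "((\<lambda>t. bessel_liouville \<nu> (of_real (a * t))) has_vector_derivative
            of_real a * bessel_liouville' \<nu> (of_real (a * t))) (at t)"
    and "((\<lambda>t. of_real a * bessel_liouville' \<nu> (of_real (a * t))) has_vector_derivative
            - (of_real (a\<^sup>2) + (1/4 - \<nu>\<^sup>2) / (of_real t)\<^sup>2) * bessel_liouville \<nu> (of_real (a * t))) (at t)"
proof -
  have pos: "of_real a * of_real t \<notin> (\<real>\<^sub>\<le>\<^sub>0 :: complex set)"
    using mult_pos_pos[OF assms] by (simp flip: of_real_mult)
  have lin: "((\<lambda>w. of_real a * w) has_field_derivative of_real a) (at w)" for w :: complex
    by (auto intro!: derivative_eq_intros)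
  have "((\<lambda>w. bessel_liouville \<nu> (of_real a * w)) has_field_derivative
            bessel_liouville' \<nu> (of_real a * of_real t) * of_real a) (at (of_real t))"
    by (rule DERIV_chain2[OF DERIV_bessel_liouville[OF pos] lin])
  from has_vector_derivative_real_field[OF this]
  show "((\<lambda>t. bessel_liouville \<nu> (of_real (a * t))) has_vector_derivative
            of_real a * bessel_liouville' \<nu> (of_real (a * t))) (at t)"
    by (simp add: mult_ac)
  have "((\<lambda>w. of_real a * bessel_liouville' \<nu> (of_real a * w)) has_field_derivative
            of_real a * (- (1 + (1/4 - \<nu>\<^sup>2) / (of_real a * of_real t)\<^sup>2)
              * bessel_liouville \<nu> (of_real a * of_real t) * of_real a)) (at (of_real t))"
    by (intro DERIV_cmult DERIV_chain2[OF DERIV_bessel_liouville'[OF pos] lin])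
  from has_vector_derivative_real_field[OF this]
  have "((\<lambda>t. of_real a * bessel_liouville' \<nu> (of_real (a * t))) has_vector_derivative
            of_real a * (- (1 + (1/4 - \<nu>\<^sup>2) / (of_real a * of_real t)\<^sup>2)
              * bessel_liouville \<nu> (of_real a * of_real t) * of_real a)) (at t)"
    by simp
  also have "of_real a * (- (1 + (1/4 - \<nu>\<^sup>2) / (of_real a * of_real t)\<^sup>2)
              * bessel_liouville \<nu> (of_real a * of_real t) * of_real a) =
      - (of_real (a\<^sup>2) + (1/4 - \<nu>\<^sup>2) / (of_real t)\<^sup>2) * bessel_liouville \<nu> (of_real (a * t))"
  proof -
    have "x * (- (1 + q / (x * y)\<^sup>2) * u * x) = - (x\<^sup>2 + q / y\<^sup>2) * u" if "x \<noteq> 0" for x y q u :: complex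
    proof -
      have "x\<^sup>2 * (q / (x * y)\<^sup>2) = q / y\<^sup>2"
        using that by (simp add: power_mult_distrib)
      moreover have "x * (- (1 + r) * u * x) = - (x\<^sup>2 + x\<^sup>2 * r) * u" for r
        by algebra
      ultimately show ?thesis
        by (simp only:)
    qed
    then show ?thesis
      using assms by simp
  qed
  finally show "((\<lambda>t. of_real a * bessel_liouville' \<nu> (of_real (a * t))) has_vector_derivative
            - (of_real (a\<^sup>2) + (1/4 - \<nu>\<^sup>2) / (of_real t)\<^sup>2) * bessel_liouville \<nu> (of_real (a * t))) (at t)" .
qed

text \<open>
  The frequencies \<open>a \<noteq> b\<close> make the product oscillate without a resonant part: in
  \<open>(t\<^sup>-\<^sup>\<sigma> W)' = (a\<^sup>2 - b\<^sup>2) t\<^sup>-\<^sup>\<sigma> u v + O(t powr (- Re \<sigma> - 1))\<close> the leading coefficient does not vanish, and dividing by it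
  expresses the integrand as a derivative up to an absolutely integrable error.
\<close>

lemma liouville_product_integral_convergent:
  fixes f :: "real \<Rightarrow> complex" and K \<sigma> \<mu> \<nu> :: complex and a b :: real
  assumes "a > 0" "b > 0" "a \<noteq> b" and \<sigma>: "Re \<sigma> > 0"
    and contf: "continuous_on {0..} f"
    and f: "\<And>t. t \<ge> 1 \<Longrightarrow> f t = K * (of_real t powr (- \<sigma>)
              * (bessel_liouville \<mu> (of_real (a * t)) * bessel_liouville \<nu> (of_real (b * t))))"
  shows "\<exists>I. ((\<lambda>T. integral {0..T} f) \<longlongrightarrow> I) at_top"
proof -
  define u u' v v' where "u = (\<lambda>t. bessel_liouville \<mu> (of_real (a * t)))"
    and "u' = (\<lambda>t. of_real a * bessel_liouville' \<mu> (of_real (a * t)))"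
    and "v = (\<lambda>t. bessel_liouville \<nu> (of_real (b * t)))"
    and "v' = (\<lambda>t. of_real b * bessel_liouville' \<nu> (of_real (b * t)))"
  define qa qb D where "qa = 1/4 - \<mu>\<^sup>2" and "qb = 1/4 - \<nu>\<^sup>2" and "D = (of_real (a\<^sup>2 - b\<^sup>2) :: complex)"
  have D: "D \<noteq> 0"
    using assms unfolding D_def of_real_eq_0_iff by (simp add: power2_eq_iff)
  define P W where "P = (\<lambda>t::real. (of_real t :: complex) powr (- \<sigma>))" and "W = (\<lambda>t. u t * v' t - u' t * v t)"
  obtain A where A: "\<And>t. t \<ge> 1 \<Longrightarrow> norm (u t) \<le> A" "\<And>t. t \<ge> 1 \<Longrightarrow> norm (u' t) \<le> A"
    using bessel_liouville_scaled_bounded[OF \<open>a > 0\<close>, of \<mu>] unfolding u_def u'_def by metis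
  obtain B where B: "\<And>t. t \<ge> 1 \<Longrightarrow> norm (v t) \<le> B" "\<And>t. t \<ge> 1 \<Longrightarrow> norm (v' t) \<le> B"
    using bessel_liouville_scaled_bounded[OF \<open>b > 0\<close>, of \<nu>] unfolding v_def v'_def by metis
  have A0: "A \<ge> 0" and B0: "B \<ge> 0"
    using order_trans[OF norm_ge_zero A(1)[of 1]] order_trans[OF norm_ge_zero B(1)[of 1]] by auto
  have uv: "norm (u t * v t) \<le> A * B" and W: "norm (W t) \<le> 2 * (A * B)" if "t \<ge> 1" for t
  proof -
    have "norm (u t * v' t) \<le> A * B" "norm (u' t * v t) \<le> A * B"
      unfolding norm_mult using A0 B0 by (intro mult_mono A B that; simp)+
    then show "norm (W t) \<le> 2 * (A * B)"
      unfolding W_def using norm_triangle_ineq4[of "u t * v' t" "u' t * v t"] by linarith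
    show "norm (u t * v t) \<le> A * B"
      unfolding norm_mult using A0 B0 by (intro mult_mono A B that; simp)
  qed
  have normP: "norm (P t) = t powr (- Re \<sigma>)" if "t \<ge> 1" for t
    using that by (simp add: P_def norm_powr_real_powr)
  define J where "J = (\<lambda>T. integral {0..T} f)"
  have dJ: "(J has_vector_derivative K * (P t * (u t * v t))) (at t)" if "t \<ge> 1" for t
  proof -
    have "(J has_vector_derivative f t) (at t within {0..t + 1})"
      unfolding J_def using that by (intro integral_has_vector_derivative continuous_on_subset[OF contf]) auto
    moreover have "at t within {0..t + 1} = at t"
      using that by (intro at_within_interior) simp
    ultimately have "(J has_vector_derivative f t) (at t)"
      by (simp only:)
    then show ?thesis
      unfolding f[OF that] P_def u_def v_def .
  qed
  have dW: "(W has_vector_derivative (D + (qa - qb) / (of_real t)\<^sup>2) * (u t * v t)) (at t)" if "t \<ge> 1" for t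
  proof -
    have t: "t > 0" using that by simp
    have du: "(u has_vector_derivative u' t) (at t)"
        "(u' has_vector_derivative - (of_real (a\<^sup>2) + qa / (of_real t)\<^sup>2) * u t) (at t)"
      unfolding u_def u'_def qa_def by (rule has_vector_derivative_liouville_scaled[OF \<open>a > 0\<close> t])+
    have dv: "(v has_vector_derivative v' t) (at t)"
        "(v' has_vector_derivative - (of_real (b\<^sup>2) + qb / (of_real t)\<^sup>2) * v t) (at t)"
      unfolding v_def v'_def qb_def by (rule has_vector_derivative_liouville_scaled[OF \<open>b > 0\<close> t])+
    have "(W has_vector_derivative
        (u t * (- (of_real (b\<^sup>2) + qb / (of_real t)\<^sup>2) * v t) + u' t * v' t)
        - (u' t * v' t + (- (of_real (a\<^sup>2) + qa / (of_real t)\<^sup>2) * u t) * v t)) (at t)"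
      unfolding W_def by (intro has_vector_derivative_diff has_vector_derivative_mult du dv)
    moreover have "(u t * (- (b2 + rb) * v t) + u' t * v' t) - (u' t * v' t + (- (a2 + ra) * u t) * v t)
        = (a2 - b2 + (ra - rb)) * (u t * v t)" for a2 b2 ra rb
      by algebra
    ultimately show ?thesis
      by (simp only: D_def of_real_diff diff_divide_distrib)
  qed
  have dP: "(P has_vector_derivative P t * - (\<sigma> / of_real t)) (at t)" if "t \<ge> 1" for t
    unfolding P_def using that by (intro has_vector_derivative_real_field
        DERIV_powr_divide[where s = "- \<sigma>", unfolded minus_divide_left[symmetric]]) auto
  \<comment> \<open>The integral minus the boundary term; its derivative is the absolutely integrable error.\<close>
  define p where "p = (\<lambda>t. J t - K / D * (P t * W t))"
  define p' where "p' = (\<lambda>t. K / D * (P t * (\<sigma> / of_real t * W t - (qa - qb) / (of_real t)\<^sup>2 * (u t * v t))))"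
  have "\<exists>L. (p \<longlongrightarrow> L) at_top"
  proof (rule convergent_of_powr_derivative_bound[OF \<sigma>])
    fix t :: real assume t: "t \<ge> 1"
    have "(p has_vector_derivative K * (P t * (u t * v t)) -
        K / D * (P t * ((D + (qa - qb) / (of_real t)\<^sup>2) * (u t * v t)) + P t * - (\<sigma> / of_real t) * W t)) (at t)"
      unfolding p_def
      by (intro has_vector_derivative_diff has_vector_derivative_mult_right has_vector_derivative_mult dJ dP dW t)
    moreover have "K * (P t * (u t * v t)) -
        K / D * (P t * ((D + r) * (u t * v t)) + P t * - (\<sigma> / of_real t) * W t) =
        K / D * (P t * (\<sigma> / of_real t * W t - r * (u t * v t)))" for r
    proof -
      have "K = K / D * D" using D by simp
      then have "K * (P t * (u t * v t)) = K / D * (D * (P t * (u t * v t)))"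
        by (metis mult.assoc)
      moreover have "M * (D * (x * w)) - M * (x * ((D + r) * w) + x * - s * y) = M * (x * (s * y - r * w))"
        for M x w s y
        by algebra
      ultimately show ?thesis
        by (simp only:)
    qed
    ultimately show "(p has_vector_derivative p' t) (at t)"
      by (simp only: p'_def)
    have "norm (\<sigma> / of_real t * W t - (qa - qb) / (of_real t)\<^sup>2 * (u t * v t))
        \<le> norm (\<sigma> / of_real t * W t) + norm ((qa - qb) / (of_real t)\<^sup>2 * (u t * v t))"
      by (rule norm_triangle_ineq4)
    also have "\<dots> = norm \<sigma> / t * norm (W t) + norm (qa - qb) / t\<^sup>2 * norm (u t * v t)"
      using t by (simp add: norm_mult norm_divide norm_power)
    also have "\<dots> \<le> norm \<sigma> / t * (2 * (A * B)) + norm (qa - qb) / t * (A * B)"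
      using t A0 B0 by (intro add_mono mult_mono uv W divide_left_mono) (auto simp: power2_eq_square)
    also have "\<dots> = (2 * norm \<sigma> + norm (qa - qb)) * (A * B) / t"
      by (simp only: divide_inverse) algebra
    finally have "norm (p' t) \<le> norm (K / D) * (t powr (- Re \<sigma>) * ((2 * norm \<sigma> + norm (qa - qb)) * (A * B) / t))"
      unfolding p'_def norm_mult[of "K / D"] norm_mult[of "P t"] normP[OF t] by (intro mult_left_mono) auto
    also have "\<dots> = norm (K / D) * ((2 * norm \<sigma> + norm (qa - qb)) * (A * B)) * t powr (- Re \<sigma> - 1)"
      using t by (simp add: powr_diff)
    finally show "norm (p' t) \<le> norm (K / D) * ((2 * norm \<sigma> + norm (qa - qb)) * (A * B)) * t powr (- Re \<sigma> - 1)" .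
  qed
  then obtain L where L: "(p \<longlongrightarrow> L) at_top" ..
  have "((\<lambda>t. P t * W t) \<longlongrightarrow> 0) at_top"
  proof (rule Lim_null_comparison)
    show "\<forall>\<^sub>F t in at_top. norm (P t * W t) \<le> t powr (- Re \<sigma>) * (2 * (A * B))"
      using eventually_ge_at_top[of 1]
      by eventually_elim (auto simp: norm_mult normP intro!: mult_left_mono W)
    show "((\<lambda>t. t powr (- Re \<sigma>) * (2 * (A * B))) \<longlongrightarrow> 0) at_top"
      using \<sigma> by real_asymp
  qed
  then have "((\<lambda>t. p t + K / D * (P t * W t)) \<longlongrightarrow> L + K / D * 0) at_top"
    by (intro tendsto_add L tendsto_mult_left)
  then show ?thesis
    unfolding p_def J_def by auto
qed

section \<open>The product of two Bessel functions\<close>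

text \<open>
  The factor \<open>z\<^sup>2\<^sup>k\<close> is unbounded in vertical directions; this lets it be absorbed into an arbitrarily
  small increase of the exponential type.
\<close>

lemma one_plus_power_le_exp:
  assumes "\<delta> > 0"
  shows "\<exists>M\<ge>0. \<forall>y\<ge>0. (1 + y) ^ m \<le> M * exp (\<delta> * y :: real)"
proof (cases "m = 0")
  case True
  then show ?thesis using assms by (intro exI[of _ 1]) auto
next
  case False
  define K where "K = 1 + real m / \<delta>"
  have "(1 + y) ^ m \<le> K ^ m * exp (\<delta> * y)" if "y \<ge> 0" for y
  proof -
    have "real m / \<delta> * (\<delta> * y / real m) = y"
      using False assms by simp
    moreover have "(1 + r) * (1 + w) = (1 + r * w) + (r + w)" for r w :: real
      by algebra
    ultimately have "K * (1 + \<delta> * y / real m) = (1 + y) + (real m / \<delta> + \<delta> * y / real m)"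
      unfolding K_def by (simp only:)
    then have "1 + y \<le> K * (1 + \<delta> * y / real m)"
      using that assms by simp
    then have "(1 + y) ^ m \<le> (K * (1 + \<delta> * y / real m)) ^ m"
      using that by (intro power_mono) auto
    also have "\<dots> = K ^ m * (1 + \<delta> * y / real m) ^ m"
      by (rule power_mult_distrib)
    also have "\<dots> \<le> K ^ m * exp (\<delta> * y)"
    proof (intro mult_left_mono exp_ge_one_plus_x_over_n_power_n)
      have "- real m \<le> 0" "0 \<le> \<delta> * y" using that assms by auto
      then show "- real m \<le> \<delta> * y" by linarith
    qed (use False assms in \<open>auto simp: K_def\<close>)
    finally show ?thesis .
  qed
  moreover have "K ^ m \<ge> 0" using assms by (simp add: K_def)
  ultimately show ?thesis by blast
qed

lemma bessel_even_scaled_bound: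
  assumes "\<delta> > 0" "a > 0"
  shows "\<exists>C\<ge>0. \<forall>z. norm (bessel_even \<nu> (of_real a * z))
           \<le> C * (1 + \<bar>Re z\<bar>) powr (- Re \<nu> - 1/2) * exp ((1 + \<delta>) * a * \<bar>Im z\<bar>)"
proof -
  define p where "p = - Re \<nu> - 1/2"
  obtain C where C: "C \<ge> 0" "\<And>z. norm (bessel_even \<nu> z) \<le> C * (1 + \<bar>Re z\<bar>) powr p * exp ((1 + \<delta>) * \<bar>Im z\<bar>)"
    using bessel_even_exp_type_bound[OF assms(1), of \<nu>] unfolding p_def by blast
  define K where "K = 1 + a + 1 / a"
  have "norm (bessel_even \<nu> (of_real a * z)) \<le> C * K powr \<bar>p\<bar> * (1 + \<bar>Re z\<bar>) powr p * exp ((1 + \<delta>) * a * \<bar>Im z\<bar>)" for z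
  proof -
    define x where "x = \<bar>Re z\<bar>"
    have x: "x \<ge> 0" by (simp add: x_def)
    have "K * (1 + x) = (1 + a * x) + (a + 1 / a + x + x / a)"
      by (simp add: K_def algebra_simps add_divide_distrib)
    then have 1: "1 + a * x \<le> K * (1 + x)"
      using assms x by simp
    have "1 / a * a = 1"
      using assms by simp
    then have "K * (1 + a * x) = (1 + x) + (a * x + a + a * a * x + 1 / a)"
      unfolding K_def by algebra
    then have 2: "1 + x \<le> K * (1 + a * x)"
      using assms x by simp
    have "0 < 1 + a * x"
      using assms x by (intro add_pos_nonneg) auto
    moreover have "K > 0"
      using assms by (simp add: K_def add_pos_pos)
    ultimately have le: "(1 + a * x) powr p \<le> K powr \<bar>p\<bar> * (1 + x) powr p"
      using x 1 2 by (intro powr_le_powr_comparable) auto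
    have "norm (bessel_even \<nu> (of_real a * z)) \<le> C * (1 + a * x) powr p * exp ((1 + \<delta>) * (a * \<bar>Im z\<bar>))"
      using C(2)[of "of_real a * z"] assms by (simp add: x_def abs_mult)
    also have "\<dots> \<le> C * (K powr \<bar>p\<bar> * (1 + x) powr p) * exp ((1 + \<delta>) * (a * \<bar>Im z\<bar>))"
      by (intro mult_right_mono mult_left_mono le C) auto
    finally show ?thesis
      by (simp add: x_def mult.assoc)
  qed
  then show ?thesis
    unfolding p_def using C(1) by (intro exI[of _ "C * K powr \<bar>- Re \<nu> - 1/2\<bar>"]) auto
qed

text \<open>
  Since \<open>a + b\<close> is strictly below \<open>2 \<pi>\<close>, there is room for the losses \<open>\<delta> a\<close> and \<open>\<delta> b\<close> of the two Bessel
  factors and the loss \<open>\<delta>\<close> of the power.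
\<close>

lemma bessel_product_exp_type_bound:
  fixes a b :: real
  assumes "a > 0" "b > 0" "a + b < 2 * pi"
  shows "\<exists>C c. c < 2 * pi \<and> (\<forall>z. norm (K * (z ^ (2 * k) * (bessel_even \<mu> (of_real a * z) * bessel_even \<nu> (of_real b * z))))
            \<le> C * (1 + \<bar>Re z\<bar>) powr (- Re (\<mu> + \<nu> - 2 * of_nat k + 1)) * exp (c * \<bar>Im z\<bar>))"
proof -
  \<comment> \<open>Chosen so that the total type \<open>(1 + \<delta>) (a + b) + \<delta>\<close> is the midpoint of \<open>a + b\<close> and \<open>2 \<pi>\<close>.\<close>
  define \<delta> where "\<delta> = (2 * pi - (a + b)) / (2 * (1 + a + b))"
  have \<delta>: "\<delta> > 0" using assms by (simp add: \<delta>_def)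
  define c where "c = \<delta> + (1 + \<delta>) * a + (1 + \<delta>) * b"
  have "\<delta> * (1 + a + b) = (2 * pi - (a + b)) / 2"
    using assms by (simp add: \<delta>_def field_simps)
  then have c: "c < 2 * pi"
    using assms by (simp add: c_def algebra_simps)
  obtain M where M: "M \<ge> 0" "\<And>y. y \<ge> 0 \<Longrightarrow> (1 + y) ^ (2 * k) \<le> M * exp (\<delta> * y)"
    using one_plus_power_le_exp[OF \<delta>, of "2 * k"] by blast
  obtain A where A: "A \<ge> 0" "\<And>z. norm (bessel_even \<mu> (of_real a * z))
           \<le> A * (1 + \<bar>Re z\<bar>) powr (- Re \<mu> - 1/2) * exp ((1 + \<delta>) * a * \<bar>Im z\<bar>)"
    using bessel_even_scaled_bound[OF \<delta> assms(1)] by blast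
  obtain B where B: "B \<ge> 0" "\<And>z. norm (bessel_even \<nu> (of_real b * z))
           \<le> B * (1 + \<bar>Re z\<bar>) powr (- Re \<nu> - 1/2) * exp ((1 + \<delta>) * b * \<bar>Im z\<bar>)"
    using bessel_even_scaled_bound[OF \<delta> assms(2)] by blast
  have "norm (K * (z ^ (2 * k) * (bessel_even \<mu> (of_real a * z) * bessel_even \<nu> (of_real b * z))))
      \<le> norm K * (M * A * B) * (1 + \<bar>Re z\<bar>) powr (- Re (\<mu> + \<nu> - 2 * of_nat k + 1)) * exp (c * \<bar>Im z\<bar>)" for z
  proof -
    define x y where "x = \<bar>Re z\<bar>" and "y = \<bar>Im z\<bar>"
    have xy: "x \<ge> 0" "y \<ge> 0" by (auto simp: x_def y_def)
    have "norm z \<le> x + y"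
      unfolding x_def y_def by (rule cmod_le)
    also have "\<dots> \<le> (1 + x) * (1 + y)"
      using xy by (simp add: algebra_simps)
    finally have "norm z ^ (2 * k) \<le> ((1 + x) * (1 + y)) ^ (2 * k)"
      by (intro power_mono) auto
    also have "\<dots> = (1 + x) powr (2 * real k) * (1 + y) ^ (2 * k)"
      using xy by (simp add: power_mult_distrib powr_realpow[symmetric])
    also have "\<dots> \<le> (1 + x) powr (2 * real k) * (M * exp (\<delta> * y))"
      using xy M by (intro mult_left_mono) auto
    finally have z: "norm z ^ (2 * k) \<le> (1 + x) powr (2 * real k) * (M * exp (\<delta> * y))" .
    have "norm (K * (z ^ (2 * k) * (bessel_even \<mu> (of_real a * z) * bessel_even \<nu> (of_real b * z))))
       = norm K * (norm z ^ (2 * k) * (norm (bessel_even \<mu> (of_real a * z)) * norm (bessel_even \<nu> (of_real b * z))))"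
      by (simp add: norm_mult norm_power)
    also have "\<dots> \<le> norm K * (((1 + x) powr (2 * real k) * (M * exp (\<delta> * y))) *
       ((A * (1 + x) powr (- Re \<mu> - 1/2) * exp ((1 + \<delta>) * a * y)) *
        (B * (1 + x) powr (- Re \<nu> - 1/2) * exp ((1 + \<delta>) * b * y))))"
      using M(1) A(1) B(1) z A(2)[of z] B(2)[of z]
      by (intro mult_left_mono mult_mono mult_nonneg_nonneg) (auto simp: x_def y_def)
    also have "\<dots> = norm K * (M * A * B)
       * ((1 + x) powr (2 * real k) * (1 + x) powr (- Re \<mu> - 1/2) * (1 + x) powr (- Re \<nu> - 1/2))
       * (exp (\<delta> * y) * exp ((1 + \<delta>) * a * y) * exp ((1 + \<delta>) * b * y))"
      by (simp only: mult_ac)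
    also have "\<dots> = norm K * (M * A * B) * (1 + x) powr (2 * real k + (- Re \<mu> - 1/2) + (- Re \<nu> - 1/2))
       * exp (\<delta> * y + (1 + \<delta>) * a * y + (1 + \<delta>) * b * y)"
      by (simp only: powr_add exp_add)
    also have "2 * real k + (- Re \<mu> - 1/2) + (- Re \<nu> - 1/2) = - Re (\<mu> + \<nu> - 2 * of_nat k + 1)"
      by simp
    also have "\<delta> * y + (1 + \<delta>) * a * y + (1 + \<delta>) * b * y = c * y"
      by (simp add: c_def algebra_simps)
    finally show ?thesis
      unfolding x_def y_def .
  qed
  with c show ?thesis by blast
qed

lemma bessel_quotient_eq:
  assumes "a > 0" "b > 0" "t > 0"
  shows "bessel_quotient a b k \<mu> \<nu> t = (of_real (a / 2) powr \<mu> * of_real (b / 2) powr \<nu>)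
    * (of_real t ^ (2 * k) * (bessel_even \<mu> (of_real a * of_real t) * bessel_even \<nu> (of_real b * of_real t)))"
proof -
  have split: "(of_real (c * t) / 2) powr s = of_real (c / 2) powr s * (of_real t :: complex) powr s"
    if "c > 0" for c :: real and s :: complex
  proof -
    have "(of_real (c * t) / 2 :: complex) = of_real (c / 2) * of_real t" by simp
    then show ?thesis
      using that assms by (simp only:) (intro powr_times_real; simp)
  qed
  have "(of_real t :: complex) powr (2 * of_nat k) = of_real t ^ (2 * k)"
    using assms powr_nat[of "of_real t" "2 * k"] by simp
  then have "(of_real t :: complex) powr (\<mu> + \<nu> - 2 * of_nat k) = of_real t powr \<mu> * of_real t powr \<nu> / of_real t ^ (2 * k)"
    by (simp add: powr_diff powr_add)
  moreover have J: "bessel_J s (of_real (c * t))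
      = of_real (c / 2) powr s * of_real t powr s * bessel_even s (of_real c * of_real t)" if "c > 0" for c s
    using that assms by (subst bessel_J_eq_bessel_even) (simp_all only: split[OF that], simp_all)
  moreover have "(A * x * g) * (B * y * h) / (x * y / T) = (A * B) * (T * (g * h))"
    if "x \<noteq> 0" "y \<noteq> 0" for A B x y g h T :: complex
    using that by (simp add: mult_ac)
  ultimately show ?thesis
    using assms by (simp only: bessel_quotient_def powr_eq_0_iff of_real_eq_0_iff not_False_eq_True)
qed

theorem corollary1:
  fixes a b :: real and k :: nat and \<mu> \<nu> :: complex
  assumes "0 < b" and "b < a" and "a < pi"
    and "Re \<mu> > 2 * real k - 1 / 2" and "Re \<nu> > - 1 / 2"
  shows "\<exists>L I.
    (bessel_quotient a b k \<mu> \<nu> \<longlongrightarrow> L) (at_right 0) \<and>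
    (\<forall>T>0. bessel_quotient a b k \<mu> \<nu> integrable_on {0..T}) \<and>
    ((\<lambda>T. integral {0..T} (bessel_quotient a b k \<mu> \<nu>)) \<longlongrightarrow> I) at_top \<and>
    (\<lambda>n. neumann_factor n * (if n = 0 then L else bessel_quotient a b k \<mu> \<nu> (real n))) sums I"
proof -
  have a: "a > 0" using assms by simp
  define \<sigma> where "\<sigma> = \<mu> + \<nu> - 2 * of_nat k + 1"
  have \<sigma>: "Re \<sigma> > 0" using assms by (simp add: \<sigma>_def)
  define K where "K = (of_real (a / 2) powr \<mu> * of_real (b / 2) powr \<nu> :: complex)"
  define F where "F = (\<lambda>z. K * (z ^ (2 * k) * (bessel_even \<mu> (of_real a * z) * bessel_even \<nu> (of_real b * z))))"
  have quot: "bessel_quotient a b k \<mu> \<nu> t = F (of_real t)" if "t > 0" for t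
    unfolding F_def K_def by (rule bessel_quotient_eq[OF a assms(1) that])
  have holG: "(\<lambda>z. bessel_even s (of_real c * z)) holomorphic_on UNIV" for s and c :: real
  proof -
    have "bessel_even s holomorphic_on UNIV"
      using DERIV_bessel_even by (auto simp: holomorphic_on_open)
    then have "bessel_even s \<circ> (\<lambda>z. of_real c * z) holomorphic_on UNIV"
      by (intro holomorphic_on_compose_gen[where t = UNIV] holomorphic_intros) auto
    then show ?thesis by (simp add: o_def)
  qed
  have holF: "F holomorphic_on UNIV"
    unfolding F_def by (intro holomorphic_intros holG)
  have contF: "continuous_on A (\<lambda>t::real. F (of_real t))" for A
    by (rule continuous_on_compose2[OF holomorphic_on_imp_continuous_on[OF holF]]) (auto intro!: continuous_intros)
  obtain C c where C: "c < 2 * pi"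
      "\<And>z. norm (F z) \<le> C * (1 + \<bar>Re z\<bar>) powr (- Re \<sigma>) * exp (c * \<bar>Im z\<bar>)"
    using bessel_product_exp_type_bound[OF a assms(1), of K k \<mu> \<nu>] assms unfolding F_def \<sigma>_def by auto
  have even: "F (- z) = F z" for z
    by (simp add: F_def)
  obtain I where I: "((\<lambda>T. integral {0..T} (\<lambda>t. F (of_real t))) \<longlongrightarrow> I) at_top"
  proof -
    define H where "H = (of_real a powr (\<mu> + 1/2) * of_real b powr (\<nu> + 1/2) :: complex)"
    have H: "H \<noteq> 0" using a assms by (simp add: H_def)
    have "\<exists>I. ((\<lambda>T. integral {0..T} (\<lambda>t. F (of_real t))) \<longlongrightarrow> I) at_top"
    proof (rule liouville_product_integral_convergent[OF a assms(1) _ \<sigma>])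
      fix t :: real assume "t \<ge> 1"
      then have t: "t > 0" by simp
      have sp: "of_real (x * t) powr s = of_real x powr s * (of_real t :: complex) powr s" if "x > 0" for x s
        unfolding of_real_mult using that t by (intro powr_times_real) auto
      have "(of_real t :: complex) powr (- \<sigma>) * of_real t powr (\<mu> + 1/2) * of_real t powr (\<nu> + 1/2)
          = of_real t powr (of_nat (2 * k))"
        by (simp add: \<sigma>_def flip: powr_add)
      also have "\<dots> = of_real t ^ (2 * k)"
        using t by (subst powr_nat) auto
      finally have pw: "(of_real t :: complex) powr (- \<sigma>) * of_real t powr (\<mu> + 1/2) * of_real t powr (\<nu> + 1/2) = of_real t ^ (2 * k)" .
      have "of_real t powr (- \<sigma>) * (bessel_liouville \<mu> (of_real (a * t)) * bessel_liouville \<nu> (of_real (b * t)))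
          = H * ((of_real t powr (- \<sigma>) * of_real t powr (\<mu> + 1/2) * of_real t powr (\<nu> + 1/2))
              * (bessel_even \<mu> (of_real (a * t)) * bessel_even \<nu> (of_real (b * t))))"
        unfolding bessel_liouville_def sp[OF a] sp[OF assms(1)] H_def by (simp only: mult_ac)
      then have "of_real t powr (- \<sigma>) * (bessel_liouville \<mu> (of_real (a * t)) * bessel_liouville \<nu> (of_real (b * t)))
          = H * (of_real t ^ (2 * k) * (bessel_even \<mu> (of_real (a * t)) * bessel_even \<nu> (of_real (b * t))))"
        by (simp only: pw)
      then show "F (of_real t) = K / H * (of_real t powr (- \<sigma>)
              * (bessel_liouville \<mu> (of_real (a * t)) * bessel_liouville \<nu> (of_real (b * t))))"
        using H by (simp add: F_def)
    qed (use assms contF in auto)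
    then show thesis using that by blast
  qed
  have "((\<lambda>t. F (of_real t)) \<longlongrightarrow> F (of_real 0)) (at 0)"
    using contF[of UNIV] by (simp only: continuous_on_def) blast
  then have "((\<lambda>t. F (of_real t)) \<longlongrightarrow> F (of_real 0)) (at_right 0)"
    by (rule tendsto_within_subset) simp
  moreover have "\<forall>\<^sub>F t in at_right 0. F (of_real t) = bessel_quotient a b k \<mu> \<nu> t"
    using eventually_at_right_less by eventually_elim (simp only: quot)
  ultimately have "(bessel_quotient a b k \<mu> \<nu> \<longlongrightarrow> F (of_real 0)) (at_right 0)"
    by (rule Lim_transform_eventually)
  then have L: "(bessel_quotient a b k \<mu> \<nu> \<longlongrightarrow> F 0) (at_right 0)"
    by simp
  \<comment> \<open>At \<open>t = 0\<close> the quotient takes a junk value, which a null set absorbs.\<close>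
  have hi: "(bessel_quotient a b k \<mu> \<nu> has_integral integral {0..T} (\<lambda>t. F (of_real t))) {0..T}" for T
  proof (rule has_integral_spike[of "{0}"])
    show "((\<lambda>t. F (of_real t)) has_integral integral {0..T} (\<lambda>t. F (of_real t))) {0..T}"
      by (intro integrable_integral integrable_continuous_real contF)
  qed (auto simp: quot)
  have "(\<lambda>n. neumann_factor n * F (of_nat n)) sums I"
    by (rule even_sums_integral[OF holF \<sigma> C even I])
  also have "(\<lambda>n. neumann_factor n * F (of_nat n)) =
      (\<lambda>n. neumann_factor n * (if n = 0 then F 0 else bessel_quotient a b k \<mu> \<nu> (real n)))"
    by (auto simp: quot)
  finally show ?thesis
    using L hi I by (intro exI[of _ "F 0"] exI[of _ I]) (auto simp: has_integral_integrable integral_unique[OF hi])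
qed

end
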